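(* Let $K$ be a field of characteristic zero, $d\ge2$, $\nu\in K$, and let polynomials $H_1,\dots,H_{2d+2}\in K[x_1,x_2,x_3]$ be given by one of the following two definitions. (A) $H_1=0$, $H_2=\nu x_1^d$, $H_3=x_1^d-x_2^d$, $H_{i+2}=(x_1+ix_3)^d$ for $2\le i\le d$, and $H_{i+d+2}=(x_2+ix_3)^d$ for $1\le i\le d$. (B) $K$ contains a primitive $d$-th root of unity $\zeta_d$, and $H_1=0$, $H_2=\nu x_1^d$, $H_3=x_1^{d-1}x_2$, $H_{i+3}=(\zeta_d^ix_1+x_2+x_3)^d$ for $1\le i\le d-1$, and $H_{i+d+3}=(\zeta_d^ix_1+x_2-x_3)^d$ for $0\le i\le d-1$. Then $2d+2\ge6$; in case (A) $$d(x_1+x_3)^d=H_3+\sum_{i=2}^d(-1)^i\binom diH_{i+2}-\sum_{i=1}^d(-1)^i\binom diH_{i+d+2},$$ and in case (B) $$(x_1+x_2+x_3)^d=2d^2H_3-\zeta_dH_4-\zeta_d^2H_5-\cdots-\zeta_d^{2d-1}H_{2d+2}.$$ If $n=2d+2$ and $H=(H_1,\dots,H_{2d+2})$, then there exists a $T\in\mathrm{GL}_{2d+2}(K)$ such that $T(H(T^{-1}x))$ is power linear. If $3\le n\le2d+2$, then $H=(H_1,\dots,H_n)\in K[x_1,\dots,x_n]^n$ is of the form $( * )$, and: (i) If $H$ is of the form $( ** )$ (with vectors $b_i,c_i$), then $c_1$ and $c_2$ are linearly independent linear combinations of $e_1$ and $e_2$. (ii) $H$ is of the form $( ** )$ if and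 only if either $H$ is as in (A), or $H$ is as in (B) with $H_2=0$ and $d=2$. (iii) $H$ is of the form $( *** )$ if and only if $H$ is as in (A) with $H_2\ne0$.
   Context: $x=(x_1,\dots,x_n)$, vectors are column vectors, $M^{\mathrm t}$ is the transpose, $e_i$ is the $i$-th standard basis vector of $K^n$. A map $G\in K[x]^n$ is power linear (of degree $d$) if $G=\sum_{i=1}^n(a_i^{\mathrm t}x)^de_i$ for some $a_i\in K^n$. $H$ is of the form $( * )$ if for some $N\in\mathbb{N}$ there are $b_i,c_i\in K^n$ and $d_i\in\{1,\dots,d\}$ ($1\le i\le N$) with $c_j^{\mathrm t}b_i=0$ for all $1\le j\le i\le N$ and $H=\sum_{i=1}^N(c_i^{\mathrm t}x)^{d_i}b_i$. $H$ is of the form $( ** )$ if this holds with $N=n-1$. $H$ is of the form $( *** )$ if this holds with $N=n-1$ and with $b_1,\dots,b_{n-1}$ linearly independent. *)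

theory Defs
  imports "HOL-Library.Poly_Mapping" "Jordan_Normal_Form.VS_Connect"
begin

section \<open>Multivariate polynomials\<close>

text \<open>A monomial is a finitely supported exponent function, and the variable $x_i$ has index
  $i \ge 1$, as on paper. Entries of vectors and matrices are counted from 0, so the entry with
  index $i$ of a vector belongs to $x_{i+1}$.\<close>

type_synonym 'a mpoly = "(nat \<Rightarrow>\<^sub>0 nat) \<Rightarrow>\<^sub>0 'a"

definition Const :: "'a::comm_ring_1 \<Rightarrow> 'a mpoly" where
  "Const a = Poly_Mapping.single 0 a"

definition var :: "nat \<Rightarrow> 'a::comm_ring_1 mpoly" where
  "var i = Poly_Mapping.single (Poly_Mapping.single i 1) 1"

text \<open>The polynomial ring $K[x_1,\dots,x_n]$ and the set of maps $K[x_1,\dots,x_n]^n$.\<close>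

definition poly_ring :: "nat \<Rightarrow> 'a::comm_ring_1 mpoly set" where
  "poly_ring n = {p. \<forall>m \<in> Poly_Mapping.keys p. Poly_Mapping.keys m \<subseteq> {1..n}}"

definition poly_maps :: "nat \<Rightarrow> 'a::comm_ring_1 mpoly vec set" where
  "poly_maps n = {G \<in> carrier_vec n. \<forall>i<n. G $ i \<in> poly_ring n}"

definition var_vec :: "nat \<Rightarrow> 'a::comm_ring_1 mpoly vec" where
  "var_vec n = vec n (\<lambda>i. var (Suc i))"

text \<open>Substitution of \<open>s i\<close> for $x_i$.\<close>

definition subst_poly :: "(nat \<Rightarrow> 'a::comm_ring_1 mpoly) \<Rightarrow> 'a mpoly \<Rightarrow> 'a mpoly" where
  "subst_poly s p = (\<Sum>m \<in> Poly_Mapping.keys p.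
     Const (Poly_Mapping.lookup p m) *
     (\<Prod>i \<in> Poly_Mapping.keys m. s i ^ Poly_Mapping.lookup m i))"

text \<open>$G(v)$ for $v \in K[x]^n$.\<close>

definition subst_map :: "'a::comm_ring_1 mpoly vec \<Rightarrow> 'a mpoly vec \<Rightarrow> 'a mpoly vec" where
  "subst_map G v = map_vec (subst_poly (\<lambda>i. v $ (i - 1))) G"

text \<open>The linear form $c^{\mathrm t} x$.\<close>

definition lin_form :: "'a::comm_ring_1 vec \<Rightarrow> 'a mpoly" where
  "lin_form c = map_vec Const c \<bullet> var_vec (dim_vec c)"

section \<open>Linear algebra\<close>

abbreviation span_vecs :: "nat \<Rightarrow> 'a::field vec set \<Rightarrow> 'a vec set" where
  "span_vecs n S \<equiv> LinearCombinations.module.span class_ring (module_vec TYPE('a) n) S"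

text \<open>Linear independence of the family \<open>v i\<close> for \<open>i \<in> I\<close>; the library notion is about
  sets, so repetitions have to be excluded.\<close>

definition lin_indpt_family :: "nat \<Rightarrow> (nat \<Rightarrow> 'a::field vec) \<Rightarrow> nat set \<Rightarrow> bool" where
  "lin_indpt_family n v I \<longleftrightarrow> inj_on v I \<and>
     \<not> LinearCombinations.module.lin_dep class_ring (module_vec TYPE('a) n) (v ` I)"

section \<open>Power linear maps and the forms (*), (**), (***)\<close>

definition power_linear :: "nat \<Rightarrow> nat \<Rightarrow> 'a::field mpoly vec \<Rightarrow> bool" where
  "power_linear n d G \<longleftrightarrow> G \<in> poly_maps n \<and>
     (\<exists>a :: nat \<Rightarrow> 'a vec. (\<forall>i \<in> {1..n}. a i \<in> carrier_vec n) \<and>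
        G = finsum_vec TYPE('a mpoly) n
              (\<lambda>i. lin_form (a i) ^ d \<cdot>\<^sub>v unit_vec n (i - 1)) {1..n})"

text \<open>\<open>star_rep n d N b c e H\<close>: the vectors $b_i, c_i$ and the exponents $e_i$ (called $d_i$
  on paper), $1 \le i \le N$, represent $H$ in the way required for (*).\<close>

definition star_rep :: "nat \<Rightarrow> nat \<Rightarrow> nat \<Rightarrow> (nat \<Rightarrow> 'a::field vec) \<Rightarrow> (nat \<Rightarrow> 'a vec) \<Rightarrow>
    (nat \<Rightarrow> nat) \<Rightarrow> 'a mpoly vec \<Rightarrow> bool" where
  "star_rep n d N b c e H \<longleftrightarrow>
     (\<forall>i \<in> {1..N}. b i \<in> carrier_vec n \<and> c i \<in> carrier_vec n \<and> e i \<in> {1..d}) \<and>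
     (\<forall>i \<in> {1..N}. \<forall>j \<in> {1..i}. c j \<bullet> b i = 0) \<and>
     H = finsum_vec TYPE('a mpoly) n
           (\<lambda>i. lin_form (c i) ^ e i \<cdot>\<^sub>v map_vec Const (b i)) {1..N}"

definition star1 :: "nat \<Rightarrow> nat \<Rightarrow> 'a::field mpoly vec \<Rightarrow> bool" where
  "star1 n d H \<longleftrightarrow> (\<exists>N b c e. star_rep n d N b c e H)"

definition star2 :: "nat \<Rightarrow> nat \<Rightarrow> 'a::field mpoly vec \<Rightarrow> bool" where
  "star2 n d H \<longleftrightarrow> (\<exists>b c e. star_rep n d (n - 1) b c e H)"

definition star3 :: "nat \<Rightarrow> nat \<Rightarrow> 'a::field mpoly vec \<Rightarrow> bool" where
  "star3 n d H \<longleftrightarrow> (\<exists>b c e. star_rep n d (n - 1) b c e H \<and> lin_indpt_family n b {1..n - 1})"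

section \<open>The two families of polynomials\<close>

definition primitive_root_of_unity :: "nat \<Rightarrow> 'a::field \<Rightarrow> bool" where
  "primitive_root_of_unity d z \<longleftrightarrow> d > 0 \<and> z ^ d = 1 \<and> (\<forall>k \<in> {1..<d}. z ^ k \<noteq> 1)"

definition case_A :: "nat \<Rightarrow> 'a::field_char_0 \<Rightarrow> (nat \<Rightarrow> 'a mpoly) \<Rightarrow> bool" where
  "case_A d \<nu> H \<longleftrightarrow>
     H 1 = 0 \<and> H 2 = Const \<nu> * var 1 ^ d \<and> H 3 = var 1 ^ d - var 2 ^ d \<and>
     (\<forall>i \<in> {2..d}. H (i + 2) = (var 1 + of_nat i * var 3) ^ d) \<and>
     (\<forall>i \<in> {1..d}. H (i + d + 2) = (var 2 + of_nat i * var 3) ^ d)"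

definition case_B :: "nat \<Rightarrow> 'a::field_char_0 \<Rightarrow> 'a \<Rightarrow> (nat \<Rightarrow> 'a mpoly) \<Rightarrow> bool" where
  "case_B d \<nu> \<zeta> H \<longleftrightarrow>
     primitive_root_of_unity d \<zeta> \<and>
     H 1 = 0 \<and> H 2 = Const \<nu> * var 1 ^ d \<and> H 3 = var 1 ^ (d - 1) * var 2 \<and>
     (\<forall>i \<in> {1..d - 1}. H (i + 3) = (Const (\<zeta> ^ i) * var 1 + var 2 + var 3) ^ d) \<and>
     (\<forall>i \<in> {0..d - 1}. H (i + d + 3) = (Const (\<zeta> ^ i) * var 1 + var 2 - var 3) ^ d)"

text \<open>The map $(H_1,\dots,H_n)$.\<close>

definition map_of_polys :: "nat \<Rightarrow> (nat \<Rightarrow> 'a mpoly) \<Rightarrow> 'a mpoly vec" where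
  "map_of_polys n H = vec n (\<lambda>i. H (Suc i))"

end

theory Submission
  imports Defs "HOL-Computational_Algebra.Polynomial" "Jordan_Normal_Form.Determinant"
begin

text \<open>Everything rests on one property shared by (A) and (B): no nontrivial linear combination of
  $H_4, \dots, H_n$ lies in $K[x_1,x_2]$. Suppose that $H$ is of the form (**) and write
  $L_i = c_i^{\mathrm t} x$. The orthogonality relations give $c_1^{\mathrm t} H = 0$ and
  $c_2^{\mathrm t} H \in K L_1^{d_1}$, which forces first $c_1$ and then $c_2$ into the span of
  $e_1, e_2$. A nontrivial combination of $H_3, \dots, H_n$ that avoids $b_3, \dots, b_{n-1}$ is a
  binary form, hence a multiple of $H_3$, so $H_3 = p L_1^{d_1} + q L_2^{d_2}$ with constants
  $p, q$. Since $H_3$ is not invariant under any translation of $K^2$, the vectors $c_1, c_2$ are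
  independent. In case (B), the decomposition of $x_1^{d-1} x_2$ forces $d = 2$, and $\nu \ne 0$
  would make $L_1$ a multiple of $x_1$, which it is not. For (***), if $\nu = 0$ then all $b_i$ lie
  in the span of the $n-2$ vectors $e_3, \dots, e_n$.\<close>

section \<open>Evaluation of multivariate polynomials\<close>

text \<open>Origin of the families: in (A) the 2d powers of x_1 + i x_3 and x_2 + i x_3 with 1 <= i
  <= d, in (B) the 2d powers of zeta^i x_1 + x_2 + x_3 and zeta^i x_1 + x_2 - x_3 with 0 <= i < d,
  satisfy one relation modulo K[x_1,x_2] up to scaling, and the remainder in K[x_1,x_2] is a nonzero
  multiple of H_3. One of these powers is left out of H. The other 2d - 1 are then independent
  modulo K[x_1,x_2], which drives all negative statements, while for n = 2d + 2 an invertible T can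
  exchange H_3 for the omitted power, which makes the map power linear. The obstacle is that the
  exponents d_i of an unknown representation need not equal d, so H_3 cannot be compared with it
  degree by degree. The arguments therefore use polynomial functions: translations along the kernel
  of a linear form, and values at chosen points, where only positivity of the exponents matters.
  Coefficients are compared only for the known forms in H.\<close>

definition monom_val :: "(nat \<Rightarrow> 'b::comm_ring_1) \<Rightarrow> (nat \<Rightarrow>\<^sub>0 nat) \<Rightarrow> 'b" where
  "monom_val s m = (\<Prod>i \<in> Poly_Mapping.keys m. s i ^ Poly_Mapping.lookup m i)"

text \<open>The coefficient map \<open>h\<close> is left open so that one homomorphism proof covers
  both substitution of polynomials, with \<open>h = Const\<close>, and evaluation at a point, with
  \<open>h\<close> the identity.\<close>

definition eval_mpoly :: "('a::comm_ring_1 \<Rightarrow> 'b::comm_ring_1) \<Rightarrow> (nat \<Rightarrow> 'b) \<Rightarrow> 'a mpoly \<Rightarrow> 'b" where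
  "eval_mpoly h s p = (\<Sum>m \<in> Poly_Mapping.keys p. h (Poly_Mapping.lookup p m) * monom_val s m)"

lemma monom_val_superset:
  assumes "finite A" "Poly_Mapping.keys m \<subseteq> A"
  shows "monom_val s m = (\<Prod>i \<in> A. s i ^ Poly_Mapping.lookup m i)"
  unfolding monom_val_def
  using assms by (intro prod.mono_neutral_left) (auto simp: in_keys_iff)

lemma monom_val_add: "monom_val s (m + m') = monom_val s m * monom_val s m'"
proof -
  let ?A = "Poly_Mapping.keys m \<union> Poly_Mapping.keys m'"
  have "monom_val s (m + m') = (\<Prod>i \<in> ?A. s i ^ Poly_Mapping.lookup (m + m') i)"
    by (intro monom_val_superset) (auto simp: Poly_Mapping.keys_add)
  also have "\<dots> = (\<Prod>i \<in> ?A. s i ^ Poly_Mapping.lookup m i) * (\<Prod>i \<in> ?A. s i ^ Poly_Mapping.lookup m' i)"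
    by (simp add: lookup_add power_add prod.distrib)
  also have "\<dots> = monom_val s m * monom_val s m'"
    using monom_val_superset[of ?A m s] monom_val_superset[of ?A m' s] by simp
  finally show ?thesis .
qed

lemma mpoly_sum_monomials:
  "p = (\<Sum>m \<in> Poly_Mapping.keys p. Poly_Mapping.single m (Poly_Mapping.lookup p m))"
proof (rule poly_mapping_eqI)
  fix k
  show "Poly_Mapping.lookup p k =
    Poly_Mapping.lookup (\<Sum>m \<in> Poly_Mapping.keys p. Poly_Mapping.single m (Poly_Mapping.lookup p m)) k"
    by (simp add: lookup_sum lookup_single when_def in_keys_iff)
qed

lemma comm_ring_hom_eval_mpoly:
  assumes "comm_ring_hom h"
  shows "comm_ring_hom (eval_mpoly h s)"
proof -
  interpret h: comm_ring_hom h by fact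
  \<comment> \<open>Summing over a larger finite set lets two polynomials and their sum share one
    index set, although terms may cancel in the sum.\<close>
  have superset: "eval_mpoly h s p = (\<Sum>m \<in> A. h (Poly_Mapping.lookup p m) * monom_val s m)"
    if "finite A" "Poly_Mapping.keys p \<subseteq> A" for A p
    unfolding eval_mpoly_def using that
    by (intro sum.mono_neutral_left) (auto simp: in_keys_iff)
  have add: "eval_mpoly h s (p + q) = eval_mpoly h s p + eval_mpoly h s q" for p q
  proof -
    let ?A = "Poly_Mapping.keys p \<union> Poly_Mapping.keys q"
    have "eval_mpoly h s (p + q) = (\<Sum>m \<in> ?A. h (Poly_Mapping.lookup (p + q) m) * monom_val s m)"
      by (intro superset) (auto simp: Poly_Mapping.keys_add)
    also have "\<dots> = (\<Sum>m \<in> ?A. h (Poly_Mapping.lookup p m) * monom_val s m)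
        + (\<Sum>m \<in> ?A. h (Poly_Mapping.lookup q m) * monom_val s m)"
      by (simp add: lookup_add h.hom_add distrib_right sum.distrib)
    finally show ?thesis using superset[of ?A p] superset[of ?A q] by simp
  qed
  have zero: "eval_mpoly h s 0 = 0" by (simp add: eval_mpoly_def)
  have sum: "eval_mpoly h s (sum F A) = (\<Sum>x\<in>A. eval_mpoly h s (F x))" for F and A :: "(nat \<Rightarrow>\<^sub>0 nat) set"
    by (induction A rule: infinite_finite_induct) (auto simp: zero add)
  have single: "eval_mpoly h s (Poly_Mapping.single m a) = h a * monom_val s m" for m a
    by (simp add: eval_mpoly_def)
  have mult: "eval_mpoly h s (p * q) = eval_mpoly h s p * eval_mpoly h s q" for p q
  proof -
    let ?l = "Poly_Mapping.lookup" and ?k = "Poly_Mapping.keys"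
    have "p * q = (\<Sum>m \<in> ?k p. \<Sum>m' \<in> ?k q. Poly_Mapping.single (m + m') (?l p m * ?l q m'))"
      by (subst (1) mpoly_sum_monomials[of p], subst (1) mpoly_sum_monomials[of q])
        (simp add: sum_product mult_single)
    then have "eval_mpoly h s (p * q) =
        (\<Sum>m \<in> ?k p. \<Sum>m' \<in> ?k q. h (?l p m * ?l q m') * monom_val s (m + m'))"
      by (simp add: sum single)
    also have "\<dots> = eval_mpoly h s p * eval_mpoly h s q"
      by (simp add: eval_mpoly_def sum_product h.hom_mult monom_val_add mult_ac)
    finally show ?thesis .
  qed
  show ?thesis
    by unfold_locales (use single[of 0 1] in \<open>auto simp: add mult zero monom_val_def\<close>)
qed

lemma comm_ring_hom_Const: "comm_ring_hom (Const :: 'a::comm_ring_1 \<Rightarrow> 'a mpoly)"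
  by unfold_locales (auto simp: Const_def single_add mult_single)

interpretation Const: comm_ring_hom "Const :: 'a::comm_ring_1 \<Rightarrow> 'a mpoly"
  by (rule comm_ring_hom_Const)

lemma eval_mpoly_Const: "comm_ring_hom h \<Longrightarrow> eval_mpoly h s (Const a) = h a"
proof -
  assume "comm_ring_hom h"
  then interpret h: comm_ring_hom h .
  show ?thesis by (simp add: eval_mpoly_def Const_def monom_val_def)
qed

lemma eval_mpoly_var: "comm_ring_hom h \<Longrightarrow> eval_mpoly h s (var i) = s i"
proof -
  assume "comm_ring_hom h"
  then interpret h: comm_ring_hom h .
  show ?thesis by (simp add: eval_mpoly_def var_def monom_val_def)
qed

lemma subst_poly_eq_eval_mpoly: "subst_poly s = eval_mpoly Const s"
  by (simp add: fun_eq_iff subst_poly_def eval_mpoly_def monom_val_def)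

interpretation subst_poly: comm_ring_hom "subst_poly s" for s :: "nat \<Rightarrow> 'a::comm_ring_1 mpoly"
  unfolding subst_poly_eq_eval_mpoly by (rule comm_ring_hom_eval_mpoly[OF comm_ring_hom_Const])

lemma subst_poly_Const [simp]: "subst_poly s (Const a) = Const a"
  by (simp add: subst_poly_eq_eval_mpoly eval_mpoly_Const[OF comm_ring_hom_Const])

lemma subst_poly_var [simp]: "subst_poly s (var i) = s i"
  by (simp add: subst_poly_eq_eval_mpoly eval_mpoly_var[OF comm_ring_hom_Const])

definition eval_at :: "(nat \<Rightarrow> 'a::comm_ring_1) \<Rightarrow> 'a mpoly \<Rightarrow> 'a" where
  "eval_at = eval_mpoly (\<lambda>a. a)"

lemma comm_ring_hom_id: "comm_ring_hom (\<lambda>a :: 'a::comm_ring_1. a)"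
  by unfold_locales auto

interpretation eval_at: comm_ring_hom "eval_at x" for x :: "nat \<Rightarrow> 'a::comm_ring_1"
  unfolding eval_at_def by (rule comm_ring_hom_eval_mpoly[OF comm_ring_hom_id])

lemma eval_at_Const [simp]: "eval_at x (Const a) = a"
  by (simp add: eval_at_def eval_mpoly_Const[OF comm_ring_hom_id])

lemma eval_at_var [simp]: "eval_at x (var i) = x i"
  by (simp add: eval_at_def eval_mpoly_var[OF comm_ring_hom_id])

section \<open>Polynomial rings and linear forms\<close>

lemma poly_ring_Const [simp]: "Const a \<in> poly_ring n"
  by (simp add: poly_ring_def Const_def)

lemma poly_ring_var: "i \<in> {1..n} \<Longrightarrow> var i \<in> poly_ring n"
  by (simp add: poly_ring_def var_def)

lemma poly_ring_add: "p \<in> poly_ring n \<Longrightarrow> q \<in> poly_ring n \<Longrightarrow> p + q \<in> poly_ring n"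
  using Poly_Mapping.keys_add[of p q] unfolding poly_ring_def by blast

lemma poly_ring_mult:
  assumes "p \<in> poly_ring n" "q \<in> poly_ring n"
  shows "p * q \<in> poly_ring n"
  unfolding poly_ring_def
proof (intro CollectI ballI)
  fix m assume "m \<in> Poly_Mapping.keys (p * q)"
  then obtain a b where "m = a + b" "a \<in> Poly_Mapping.keys p" "b \<in> Poly_Mapping.keys q"
    using keys_mult[of p q] by blast
  then show "Poly_Mapping.keys m \<subseteq> {1..n}"
    using assms Poly_Mapping.keys_add[of a b] unfolding poly_ring_def by blast
qed

lemma poly_ring_uminus: "p \<in> poly_ring n \<Longrightarrow> - p \<in> poly_ring n"
  by (simp add: poly_ring_def)

lemma poly_ring_diff: "p \<in> poly_ring n \<Longrightarrow> q \<in> poly_ring n \<Longrightarrow> p - q \<in> poly_ring n"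
  using poly_ring_add[OF _ poly_ring_uminus, of p n q] by simp

lemma poly_ring_of_nat [simp]: "of_nat k \<in> poly_ring n"
  using poly_ring_Const[of "of_nat k" n] by (simp add: Const.hom_of_nat)

lemma poly_ring_0 [simp]: "0 \<in> poly_ring n"
  using poly_ring_of_nat[of 0 n] by simp

lemma poly_ring_power: "p \<in> poly_ring n \<Longrightarrow> p ^ k \<in> poly_ring n"
  using poly_ring_of_nat[of 1 n] by (induction k) (auto simp: poly_ring_mult)

lemma poly_ring_sum: "(\<And>i. i \<in> A \<Longrightarrow> f i \<in> poly_ring n) \<Longrightarrow> sum f A \<in> poly_ring n"
  by (induction A rule: infinite_finite_induct) (auto simp: poly_ring_add)

lemmas poly_ring_intros =
  poly_ring_var poly_ring_add poly_ring_mult poly_ring_diff poly_ring_power poly_ring_sum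

lemma lin_form_eq_sum: "lin_form c = (\<Sum>j<dim_vec c. Const (c $ j) * var (Suc j))"
  by (simp add: lin_form_def scalar_prod_def var_vec_def lessThan_atLeast0)

lemma eval_at_lin_form: "eval_at x (lin_form c) = (\<Sum>j<dim_vec c. c $ j * x (Suc j))"
  by (simp add: lin_form_eq_sum eval_at.hom_sum eval_at.hom_mult)

lemma subst_poly_lin_form: "subst_poly s (lin_form c) = (\<Sum>j<dim_vec c. Const (c $ j) * s (Suc j))"
  by (simp add: lin_form_eq_sum subst_poly.hom_sum subst_poly.hom_mult)

lemma poly_ring_lin_form: "c \<in> carrier_vec n \<Longrightarrow> lin_form c \<in> poly_ring n"
  unfolding lin_form_eq_sum by (auto intro!: poly_ring_intros)

text \<open>Entries count from 0, so \<open>a\<close>, \<open>b\<close>, \<open>c\<close> belong to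
  x_1, x_2, x_3. All linear forms occurring in H involve only these variables, whatever
  \<open>n\<close> is.\<close>

definition vec3 :: "nat \<Rightarrow> 'a::zero \<Rightarrow> 'a \<Rightarrow> 'a \<Rightarrow> 'a vec" where
  "vec3 n a b c = vec n (\<lambda>j. if j = 0 then a else if j = 1 then b else if j = 2 then c else 0)"

lemma vec3_carrier [simp]: "vec3 n a b c \<in> carrier_vec n"
  by (simp add: vec3_def)

lemma sum_vec3:
  fixes f :: "nat \<Rightarrow> 'b::comm_monoid_add"
  assumes "3 \<le> n" and "\<And>j. 3 \<le> j \<Longrightarrow> j < n \<Longrightarrow> f j = 0"
  shows "(\<Sum>j<n. f j) = f 0 + f 1 + f 2"
proof -
  have "(\<Sum>j<n. f j) = (\<Sum>j\<in>{0,1,2}. f j)"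
    using assms by (intro sum.mono_neutral_right) (auto simp: numeral_3_eq_3 not_less_eq_eq less_Suc_eq)
  then show ?thesis by (simp add: add.assoc)
qed

lemma lin_form_vec3:
  assumes "3 \<le> n"
  shows "lin_form (vec3 n a b c) = Const a * var 1 + Const b * var 2 + Const c * var 3"
proof -
  have "lin_form (vec3 n a b c) = (\<Sum>j<n. Const (vec3 n a b c $ j) * var (Suc j))"
    by (simp add: lin_form_eq_sum vec3_def)
  also have "\<dots> = Const a * var (Suc 0) + Const b * var (Suc 1) + Const c * var (Suc 2)"
    using assms by (subst sum_vec3) (auto simp: vec3_def)
  finally show ?thesis by (simp add: numeral_3_eq_3 numeral_2_eq_2)
qed

section \<open>Linear algebra\<close>

text \<open>Gaussian elimination: a pivot equation is solved for one unknown and substituted into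
  the others, which leaves one equation and one unknown fewer.\<close>

lemma underdetermined_system:
  fixes M :: "'i \<Rightarrow> 'j \<Rightarrow> 'a::field"
  assumes "finite I" "finite J" "card I < card J"
  shows "\<exists>y. (\<exists>j\<in>J. y j \<noteq> 0) \<and> (\<forall>i\<in>I. (\<Sum>j\<in>J. M i j * y j) = 0)"
  using assms
proof (induction I arbitrary: J M rule: finite_induct)
  case empty
  then show ?case by (intro exI[of _ "\<lambda>_. 1"]) (auto simp: card_gt_0_iff)
next
  case (insert i I)
  show ?case
  proof (cases "\<forall>j\<in>J. M i j = 0")
    case True
    obtain y where "\<exists>j\<in>J. y j \<noteq> 0" "\<forall>i\<in>I. (\<Sum>j\<in>J. M i j * y j) = 0"
      using insert.IH[of J M] insert.prems insert.hyps by auto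
    then show ?thesis using True by (intro exI[of _ y]) auto
  next
    case False
    then obtain j0 where j0: "j0 \<in> J" "M i j0 \<noteq> 0" by blast
    define J' where "J' = J - {j0}"
    have J: "J = insert j0 J'" "finite J'" "j0 \<notin> J'"
      using j0 insert.prems by (auto simp: J'_def)
    obtain y where y: "\<exists>j\<in>J'. y j \<noteq> 0"
      "\<And>i'. i' \<in> I \<Longrightarrow> (\<Sum>j\<in>J'. (M i' j - M i' j0 * M i j / M i j0) * y j) = 0"
      using insert.IH[of J' "\<lambda>i' j. M i' j - M i' j0 * M i j / M i j0"] insert.prems insert.hyps J
      by auto
    \<comment> \<open>Back substitution: the value at the pivot unknown \<open>j0\<close> is the one
      that makes equation \<open>i\<close> hold.\<close>
    define z where "z = y(j0 := - (\<Sum>j\<in>J'. M i j * y j) / M i j0)"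
    have zsum: "(\<Sum>j\<in>J. M i' j * z j) = M i' j0 * z j0 + (\<Sum>j\<in>J'. M i' j * y j)" for i'
    proof -
      have "(\<Sum>j\<in>J'. M i' j * z j) = (\<Sum>j\<in>J'. M i' j * y j)"
        using J by (intro sum.cong) (auto simp: z_def)
      then show ?thesis using J by simp
    qed
    have "(\<Sum>j\<in>J. M i j * z j) = 0" using j0 by (simp add: zsum) (simp add: z_def)
    moreover have "(\<Sum>j\<in>J. M i' j * z j) = 0" if "i' \<in> I" for i'
    proof -
      have "(\<Sum>j\<in>J'. (M i' j - M i' j0 * M i j / M i j0) * y j) =
          (\<Sum>j\<in>J'. M i' j * y j) - M i' j0 / M i j0 * (\<Sum>j\<in>J'. M i j * y j)"
        by (simp add: sum_subtractf left_diff_distrib sum_distrib_left mult.assoc)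
      with y(2)[OF that] show ?thesis by (simp add: zsum) (simp add: z_def)
    qed
    moreover have "\<exists>j\<in>J. z j \<noteq> 0" using y(1) J by (auto simp: z_def)
    ultimately show ?thesis by blast
  qed
qed

text \<open>Interpolation instead of a determinant: the relations extend linearly to all polynomials
  of degree below \<open>card I\<close>, in particular to \<open>q\<close>, which vanishes at every
  node except \<open>a i\<close>.\<close>

lemma vandermonde_trivial:
  fixes a y :: "'i \<Rightarrow> 'a::field"
  assumes "finite I" "inj_on a I" and eq: "\<And>k. k < card I \<Longrightarrow> (\<Sum>i\<in>I. y i * a i ^ k) = 0"
    and i: "i \<in> I"
  shows "y i = 0"
proof -
  define q where "q = (\<Prod>j\<in>I - {i}. [:- a j, 1:])"
  have "degree q = card (I - {i})"
    unfolding q_def by (subst degree_prod_sum_eq) auto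
  then have deg: "degree q < card I"
    using assms by (metis card_Diff1_less)
  have "(\<Sum>j\<in>I. y j * poly q (a j)) = (\<Sum>j\<in>I. \<Sum>k\<le>degree q. coeff q k * (y j * a j ^ k))"
    by (simp add: poly_altdef sum_distrib_left mult_ac)
  also have "\<dots> = (\<Sum>k\<le>degree q. coeff q k * (\<Sum>j\<in>I. y j * a j ^ k))"
    by (subst sum.swap) (simp add: sum_distrib_left)
  also have "\<dots> = 0" using eq deg by (intro sum.neutral) auto
  finally have "(\<Sum>j\<in>I. y j * poly q (a j)) = 0" .
  moreover have "(\<Sum>j\<in>I. y j * poly q (a j)) = (\<Sum>j\<in>{i}. y j * poly q (a j))"
    using assms by (intro sum.mono_neutral_right) (auto simp: q_def poly_prod)
  ultimately have "y i * poly q (a i) = 0" by simp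
  moreover have "poly q (a i) \<noteq> 0"
    using assms by (auto simp: q_def poly_prod inj_on_def)
  ultimately show ?thesis by simp
qed

text \<open>Translates independence of a set of vectors, where coefficients are attached to vectors,
  into coordinates with coefficients attached to indices.\<close>

lemma lin_indpt_family_iff:
  fixes v :: "nat \<Rightarrow> 'a::field vec"
  assumes finI: "finite I" and v: "\<And>i. i \<in> I \<Longrightarrow> v i \<in> carrier_vec n"
  shows "lin_indpt_family n v I \<longleftrightarrow>
    (\<forall>y. (\<forall>k<n. (\<Sum>i\<in>I. y i * v i $ k) = 0) \<longrightarrow> (\<forall>i\<in>I. y i = 0))"
proof -
  interpret vec_space "TYPE('a)" n .
  have sub: "v ` I \<subseteq> carrier_vec n" using v by auto
  show ?thesis
  proof (intro iffI allI impI ballI)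
    fix y i assume li: "lin_indpt_family n v I"
      and eq: "\<forall>k<n. (\<Sum>i\<in>I. y i * v i $ k) = 0" and i: "i \<in> I"
    have inj: "inj_on v I" and nd: "\<not> lin_dep (v ` I)"
      using li by (auto simp: lin_indpt_family_def)
    define a where "a = y \<circ> the_inv_into I v"
    have a: "a (v i) = y i" if "i \<in> I" for i
      using inj that by (simp add: a_def the_inv_into_f_f)
    have "lincomb a (v ` I) = 0\<^sub>v n"
    proof (rule eq_vecI)
      fix k assume "k < dim_vec (0\<^sub>v n :: 'a vec)"
      then have k: "k < n" by simp
      have "lincomb a (v ` I) $ k = (\<Sum>i\<in>I. a (v i) * v i $ k)"
        using inj by (simp add: lincomb_index[OF k sub] sum.reindex)
      then show "lincomb a (v ` I) $ k = 0\<^sub>v n $ k" using eq k a by simp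
    qed (use sub finI in simp)
    then have "lin_dep (v ` I)" if "y i \<noteq> 0"
      by (rule lin_dep_crit[OF _ subset_refl _ imageI[OF i], rotated -1]) (use that finI i a in auto)
    then show "y i = 0" using nd by blast
  next
    assume H: "\<forall>y. (\<forall>k<n. (\<Sum>i\<in>I. y i * v i $ k) = 0) \<longrightarrow> (\<forall>i\<in>I. y i = 0)"
    have inj: "inj_on v I"
    proof (rule inj_onI, rule ccontr)
      fix i j assume ij: "i \<in> I" "j \<in> I" "v i = v j" "i \<noteq> j"
      \<comment> \<open>A repeated vector would give the nontrivial relation v_i - v_j = 0.\<close>
      define y where "y = (\<lambda>l. if l = i then 1 else if l = j then - 1 else 0 :: 'a)"
      have "(\<Sum>l\<in>I. y l * v l $ k) = (\<Sum>l\<in>{i, j}. y l * v l $ k)" for k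
        by (rule sum.mono_neutral_right) (use ij(1,2) finI in \<open>simp_all add: y_def\<close>)
      then have "(\<Sum>l\<in>I. y l * v l $ k) = v i $ k - v j $ k" for k
        using ij(4) by (simp add: y_def)
      then have "(\<Sum>l\<in>I. y l * v l $ k) = 0" for k unfolding ij(3) by simp
      then have "y i = 0" using H ij(1) by blast
      then show False by (simp add: y_def)
    qed
    moreover have "\<not> lin_dep (v ` I)"
    proof
      assume "lin_dep (v ` I)"
      then obtain a w where aw: "lincomb a (v ` I) = 0\<^sub>v n" "w \<in> v ` I" "a w \<noteq> 0"
        using finite_lin_dep[of "v ` I"] finI sub by auto
      have "(\<Sum>i\<in>I. a (v i) * v i $ k) = 0" if k: "k < n" for k
        using arg_cong[OF aw(1), of "\<lambda>u. u $ k"] inj k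
        by (simp add: lincomb_index[OF k sub] sum.reindex)
      then have "\<forall>i\<in>I. a (v i) = 0" using H[rule_format, of "\<lambda>i. a (v i)"] by blast
      then show False using aw by auto
    qed
    ultimately show "lin_indpt_family n v I" by (simp add: lin_indpt_family_def)
  qed
qed

lemma in_span_unit_vecs:
  fixes v :: "'a::field vec"
  assumes n: "2 \<le> n" and v: "v \<in> carrier_vec n" and z: "\<And>j. 2 \<le> j \<Longrightarrow> j < n \<Longrightarrow> v $ j = 0"
  shows "v \<in> span_vecs n {unit_vec n 0, unit_vec n 1}"
proof -
  interpret vec_space "TYPE('a)" n .
  let ?S = "{unit_vec n 0, unit_vec n 1 :: 'a vec}"
  have sub: "?S \<subseteq> carrier_vec n" by auto
  have ne: "unit_vec n 0 \<noteq> (unit_vec n 1 :: 'a vec)"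
    using n unit_vec_eq[of 0 n 1] by auto
  define a where "a = (\<lambda>w :: 'a vec. if w = unit_vec n 0 then v $ 0 else v $ 1)"
  have dim: "dim_vec (lincomb a ?S) = n" using lincomb_dim[OF _ sub, of a] by simp
  have "v = lincomb a ?S"
  proof (rule eq_vecI)
    fix k assume "k < dim_vec (lincomb a ?S)"
    then have k: "k < n" unfolding dim .
    have "lincomb a ?S $ k = v $ 0 * unit_vec n 0 $ k + v $ 1 * unit_vec n 1 $ k"
      unfolding lincomb_index[OF k sub] using ne by (simp add: a_def)
    also have "\<dots> = v $ k"
      using n k z[of k] by (cases "k = 0"; cases "k = 1") auto
    finally show "v $ k = lincomb a ?S $ k" by simp
  qed (use v in \<open>simp only: dim carrier_vecD\<close>)
  then show ?thesis unfolding span_def by blast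
qed

section \<open>Representations with few powers\<close>

text \<open>Polynomials enter only through the functions $g_k$ that they define. The function $f$ is
  the one defined by $H_3$, and the assumption \<open>indep\<close> says that no nontrivial linear combination of
  $H_4, \dots, H_n$ lies in $K[x_1,x_2]$.\<close>

locale few_powers =
  fixes n d :: nat and \<nu> :: "'a::field_char_0" and f :: "'a \<Rightarrow> 'a \<Rightarrow> 'a"
    and g :: "nat \<Rightarrow> (nat \<Rightarrow> 'a) \<Rightarrow> 'a"
    and B C :: "nat \<Rightarrow> nat \<Rightarrow> 'a" and e :: "nat \<Rightarrow> nat"
  assumes n: "3 \<le> n"
    and g1: "g 1 x = 0"
    and g2: "g 2 x = \<nu> * x 1 ^ d"
    and g3: "g 3 x = f (x 1) (x 2)"
    and indep: "(\<And>x x'. x 1 = x' 1 \<Longrightarrow> x 2 = x' 2 \<Longrightarrow>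
        (\<Sum>k=4..n. y k * g k x) = (\<Sum>k=4..n. y k * g k x')) \<Longrightarrow> k \<in> {4..n} \<Longrightarrow> y k = 0"
    and no_period: "(\<And>s t. f (s + a) (t + b) = f s t) \<Longrightarrow> a = 0 \<and> b = 0"
    and rep: "k \<in> {1..n} \<Longrightarrow> g k x = (\<Sum>i=1..n-1. B i k * (\<Sum>j=1..n. C i j * x j) ^ e i)"
    and orth: "i \<in> {1..n-1} \<Longrightarrow> j \<in> {1..i} \<Longrightarrow> (\<Sum>k=1..n. C j k * B i k) = 0"
    and e_pos: "i \<in> {1..n-1} \<Longrightarrow> e i \<ge> 1"
begin

text \<open>If the whole combination depends only on x_1 and x_2, then so does its tail from H_4 on,
  because H_1, H_2, H_3 do. So \<open>indep\<close> removes the tail, and only the terms of H_2 and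
  H_3 remain.\<close>

lemma binary_relation:
  assumes "\<And>x. (\<Sum>k=1..n. y k * g k x) = F (x 1) (x 2)"
  shows "\<And>k. k \<in> {4..n} \<Longrightarrow> y k = 0" and "\<And>s t. y 2 * \<nu> * s ^ d + y 3 * f s t = F s t"
proof -
  have "{1..n} = insert 1 (insert 2 (insert 3 {4..n}))" using n by auto
  then have split: "(\<Sum>k=1..n. y k * g k x) = y 2 * \<nu> * x 1 ^ d + y 3 * f (x 1) (x 2) + (\<Sum>k=4..n. y k * g k x)" for x
    by (simp add: g1[simplified] g2 g3 mult_ac add_ac)
  have *: "(\<Sum>k=4..n. y k * g k x) = F (x 1) (x 2) - (y 2 * \<nu> * x 1 ^ d + y 3 * f (x 1) (x 2))" for x
    using split[of x] assms[of x] by (simp add: eq_diff_eq add.commute)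
  show **: "y k = 0" if "k \<in> {4..n}" for k
    using that by (rule indep[rotated]) (simp add: *)
  show "y 2 * \<nu> * s ^ d + y 3 * f s t = F s t" for s t
    using *[of "\<lambda>i. if i = 1 then s else t"] ** by simp
qed

text \<open>Pairing H with \<open>y\<close> replaces each b_i by the scalar y^t b_i. For y = c_j the
  relations \<open>orth\<close> then delete all powers with index i >= j.\<close>

lemma combination:
  "(\<Sum>k=1..n. y k * g k x) = (\<Sum>i=1..n-1. (\<Sum>k=1..n. y k * B i k) * (\<Sum>j=1..n. C i j * x j) ^ e i)"
proof -
  have "(\<Sum>k=1..n. y k * g k x) = (\<Sum>k=1..n. \<Sum>i=1..n-1. y k * B i k * (\<Sum>j=1..n. C i j * x j) ^ e i)"
    by (intro sum.cong) (simp_all add: rep sum_distrib_left mult_ac)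
  then show ?thesis by (subst (asm) sum.swap) (simp add: sum_distrib_right)
qed

text \<open>A function of one linear form is invariant under translations along the kernel of that
  form, which \<open>no_period\<close> forbids. The zero form, whose kernel is everything, is
  treated separately.\<close>

lemma not_single_form: "\<not> (\<forall>s t. f s t = F (a * s + b * t))"
proof
  assume H: "\<forall>s t. f s t = F (a * s + b * t)"
  show False
  proof (cases "a = 0 \<and> b = 0")
    case True
    then show False using no_period[of 1 0] H by simp
  next
    case False
    have "f (s + b) (t + - a) = f s t" for s t using H by (simp add: algebra_simps)
    from no_period[OF this] show False using False by simp
  qed
qed

lemma first_two: "1 \<in> {1..n-1}" "2 \<in> {1..n-1}" "Suc 0 \<in> {1..n-1}" "Suc 0 \<le> n - Suc 0"
  using n by auto

lemma sum_binary:
  assumes "\<And>k. k \<in> {3..n} \<Longrightarrow> c k = 0"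
  shows "(\<Sum>k=1..n. c k * x k) = c 1 * x 1 + c 2 * (x 2 :: 'a)"
proof -
  have "(\<Sum>k=1..n. c k * x k) = (\<Sum>k\<in>{1,2}. c k * x k)"
    using n assms by (intro sum.mono_neutral_right) auto
  then show ?thesis by simp
qed

text \<open>Pairing H with c_1 deletes every power. A nonzero entry of c_1 at x_3 would express f
  through x_1 alone; once that entry is zero, the surviving coefficient of x_1^d gives the second
  claim.\<close>

lemma first_form: "k \<in> {3..n} \<Longrightarrow> C 1 k = 0" and first_form_2: "C 1 2 * \<nu> = 0"
proof -
  have z: "(\<Sum>k=1..n. C 1 k * g k x) = 0" for x
    unfolding combination using orth[of _ 1] by (intro sum.neutral) auto
  note rel = binary_relation[of "C 1" "\<lambda>_ _. 0", OF z]
  have C3: "C 1 3 = 0"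
  proof (rule ccontr)
    assume c: "C 1 3 \<noteq> 0"
    have "f s t = - C 1 2 * \<nu> / C 1 3 * (1 * s + 0 * t) ^ d" for s t
      using rel(2)[of s t] c by (simp add: field_simps eq_neg_iff_add_eq_0)
    then show False using not_single_form[of "\<lambda>z. - C 1 2 * \<nu> / C 1 3 * z ^ d" 1 0] by simp
  qed
  then show "C 1 2 * \<nu> = 0" using rel(2)[of 1 0] by simp
  show "C 1 k = 0" if "k \<in> {3..n}"
    using rel(1)[of k] C3 that by (cases "k = 3") auto
qed

text \<open>A nonzero entry of c_2 at x_3 would write f through L_1^(e_1) and \<nu> x_1^d. Both
  depend on a single form: either \<nu> = 0 and only L_1 occurs, or \<open>first_form_2\<close>
  makes L_1 a multiple of x_1.\<close>

lemma second_form: "k \<in> {3..n} \<Longrightarrow> C 2 k = 0"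
proof -
  let ?c = "\<Sum>k=1..n. C 2 k * B 1 k"
  have z: "(\<Sum>k=1..n. C 2 k * g k x) = ?c * (C 1 1 * x 1 + C 1 2 * x 2) ^ e 1" for x
  proof -
    have "(\<Sum>k=1..n. C 2 k * B i k) = 0" if "i \<in> {1..n-1} - {1}" for i
      using orth[of i 2] that by auto
    then have "(\<Sum>k=1..n. C 2 k * g k x) = (\<Sum>i\<in>{1}. (\<Sum>k=1..n. C 2 k * B i k) * (\<Sum>j=1..n. C i j * x j) ^ e i)"
      unfolding combination using first_two by (intro sum.mono_neutral_right) auto
    then show ?thesis by (simp add: sum_binary[of "C 1", OF first_form, simplified])
  qed
  note rel = binary_relation[of "C 2" "\<lambda>s t. ?c * (C 1 1 * s + C 1 2 * t) ^ e 1", OF z]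
  have C3: "C 2 3 = 0"
  proof (rule ccontr)
    assume c: "C 2 3 \<noteq> 0"
    have f: "f s t = (?c * (C 1 1 * s + C 1 2 * t) ^ e 1 - C 2 2 * \<nu> * s ^ d) / C 2 3" for s t
      using rel(2)[of s t] c by (simp add: field_simps)
    show False
    proof (cases "\<nu> = 0")
      case True
      then show False
        using f not_single_form[of "\<lambda>z. ?c * z ^ e 1 / C 2 3" "C 1 1" "C 1 2"] by simp
    next
      case False
      then have "C 1 2 = 0" using first_form_2 by simp
      then show False
        using f not_single_form[of "\<lambda>z. (?c * (C 1 1 * z) ^ e 1 - C 2 2 * \<nu> * z ^ d) / C 2 3" 1 0] by simp
    qed
  qed
  show "C 2 k = 0" if "k \<in> {3..n}"
    using rel(1)[of k] C3 that by (cases "k = 3") auto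
qed

lemma form_1: "(\<Sum>j=1..n. C 1 j * x j) = C 1 1 * x 1 + C 1 2 * x 2"
  by (rule sum_binary[OF first_form])

lemma form_2: "(\<Sum>j=1..n. C 2 j * x j) = C 2 1 * x 1 + C 2 2 * x 2"
  by (rule sum_binary[OF second_form])

text \<open>Some nontrivial combination of $H_3, \dots, H_n$ avoids $b_3, \dots, b_{n-1}$, hence it is a
  binary form and therefore a multiple of $H_3$.\<close>

lemma two_powers:
  "\<exists>p q. \<forall>s t. f s t = p * (C 1 1 * s + C 1 2 * t) ^ e 1 + q * (C 2 1 * s + C 2 2 * t) ^ e 2"
proof -
  obtain y0 where y0: "\<exists>k\<in>{3..n}. y0 k \<noteq> 0" "\<forall>i\<in>{3..n-1}. (\<Sum>k=3..n. B i k * y0 k) = 0"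
  proof -
    have "card {3..n-1} < card {3..n}" using n by simp
    then show ?thesis using underdetermined_system[of "{3..n-1}" "{3..n}" B] that by blast
  qed
  \<comment> \<open>Extension by zero keeps H_1 and H_2 out of the combination, so that the term
    with \<nu> disappears from \<open>rel(2)\<close>.\<close>
  define y where "y = (\<lambda>k. if k < 3 then 0 else y0 k)"
  let ?b = "\<lambda>i. \<Sum>k=1..n. y k * B i k"
  have b: "?b i = 0" if "i \<in> {3..n-1}" for i
  proof -
    have "?b i = (\<Sum>k=3..n. y k * B i k)" by (intro sum.mono_neutral_right) (auto simp: y_def)
    also have "\<dots> = (\<Sum>k=3..n. B i k * y0 k)" by (intro sum.cong) (auto simp: y_def)
    finally show ?thesis using y0 that by simp
  qed
  have z: "(\<Sum>k=1..n. y k * g k x) =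
      ?b 1 * (C 1 1 * x 1 + C 1 2 * x 2) ^ e 1 + ?b 2 * (C 2 1 * x 1 + C 2 2 * x 2) ^ e 2" for x
  proof -
    have "(\<Sum>k=1..n. y k * g k x) = (\<Sum>i\<in>{1,2}. ?b i * (\<Sum>j=1..n. C i j * x j) ^ e i)"
      unfolding combination using n b by (intro sum.mono_neutral_right) auto
    then show ?thesis by (simp add: form_1[simplified] form_2[simplified])
  qed
  note rel = binary_relation[of y "\<lambda>s t. ?b 1 * (C 1 1 * s + C 1 2 * t) ^ e 1 + ?b 2 * (C 2 1 * s + C 2 2 * t) ^ e 2", OF z]
  have "y 3 \<noteq> 0"
  proof
    assume "y 3 = 0"
    with rel(1) have "\<forall>k\<in>{3..n}. y0 k = 0"
      by (metis y_def atLeastAtMost_iff leD le_neq_implies_less Suc_leI numeral_3_eq_3 eval_nat_numeral(2,3) semiring_norm(26,27))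
    then show False using y0 by blast
  qed
  then have "f s t = ?b 1 / y 3 * (C 1 1 * s + C 1 2 * t) ^ e 1 + ?b 2 / y 3 * (C 2 1 * s + C 2 2 * t) ^ e 2" for s t
    using rel(2)[of s t] by (simp add: y_def field_simps)
  then show ?thesis by blast
qed

text \<open>By \<open>two_powers\<close>, a common zero of L_1 and L_2 is a period of f. If the
  determinant vanished, the kernel vectors (C_12, -C_11) and (C_22, -C_21) would be such zeros,
  hence zero; then both forms vanish and (1,0) is a nonzero period.\<close>

lemma det_nonzero: "C 1 1 * C 2 2 - C 1 2 * C 2 1 \<noteq> 0"
proof
  assume det: "C 1 1 * C 2 2 - C 1 2 * C 2 1 = 0"
  obtain p q where f: "\<And>s t. f s t = p * (C 1 1 * s + C 1 2 * t) ^ e 1 + q * (C 2 1 * s + C 2 2 * t) ^ e 2"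
    using two_powers by blast
  have *: "a = 0 \<and> b = 0" if "C 1 1 * a + C 1 2 * b = 0" "C 2 1 * a + C 2 2 * b = 0" for a b
  proof (rule no_period)
    show "f (s + a) (t + b) = f s t" for s t
    proof -
      have "C i 1 * (s + a) + C i 2 * (t + b) = C i 1 * s + C i 2 * t + (C i 1 * a + C i 2 * b)" for i
        by (simp add: algebra_simps)
      then show ?thesis unfolding f using that by simp
    qed
  qed
  have "C 1 2 = 0 \<and> - C 1 1 = 0" by (rule *) (use det in \<open>auto simp: algebra_simps\<close>)
  moreover have "C 2 2 = 0 \<and> - C 2 1 = 0" by (rule *) (use det in \<open>auto simp: algebra_simps\<close>)
  ultimately show False using *[of 1 0] by simp
qed

text \<open>From i = 2 on, b_i is orthogonal to both c_1 and c_2, so its first two entries solve a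
  homogeneous 2 by 2 system with nonzero determinant.\<close>

lemma B_later: "i \<in> {2..n-1} \<Longrightarrow> B i 1 = 0" "i \<in> {2..n-1} \<Longrightarrow> B i 2 = 0"
proof -
  assume i: "i \<in> {2..n-1}"
  have "C 1 1 * B i 1 + C 1 2 * B i 2 = 0" "C 2 1 * B i 1 + C 2 2 * B i 2 = 0"
    using orth[of i 1] orth[of i 2] i form_1[of "B i"] form_2[of "B i"] by simp_all
  moreover have "(C 1 1 * C 2 2 - C 1 2 * C 2 1) * B i 1 =
      C 2 2 * (C 1 1 * B i 1 + C 1 2 * B i 2) - C 1 2 * (C 2 1 * B i 1 + C 2 2 * B i 2)"
    "(C 1 1 * C 2 2 - C 1 2 * C 2 1) * B i 2 =
      C 1 1 * (C 2 1 * B i 1 + C 2 2 * B i 2) - C 2 1 * (C 1 1 * B i 1 + C 1 2 * B i 2)"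
    by (simp_all add: algebra_simps)
  ultimately have "(C 1 1 * C 2 2 - C 1 2 * C 2 1) * B i 1 = 0" "(C 1 1 * C 2 2 - C 1 2 * C 2 1) * B i 2 = 0"
    by simp_all
  then show "B i 1 = 0" "B i 2 = 0" using det_nonzero by simp_all
qed

lemma component:
  assumes "k \<in> {1, 2}"
  shows "g k x = B 1 k * (C 1 1 * x 1 + C 1 2 * x 2) ^ e 1"
proof -
  have "g k x = (\<Sum>i\<in>{1}. B i k * (\<Sum>j=1..n. C i j * x j) ^ e i)"
  proof -
    have "B i k = 0" if "i \<in> {1..n-1} - {1}" for i
      using that assms B_later[of i] by auto
    moreover have "k \<in> {1..n}" using assms n by auto
    ultimately show ?thesis
      unfolding rep[OF \<open>k \<in> {1..n}\<close>] using first_two by (intro sum.mono_neutral_right) auto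
  qed
  then show ?thesis by (simp add: form_1[simplified])
qed

text \<open>Evaluating \<open>component\<close> at a point where L_1 equals 1 isolates the entries
  of b_1. Such a point exists since a zero form L_1 would make the determinant vanish.\<close>

lemma \<nu>_cases:
  shows "B 1 1 = 0" and "\<nu> = 0 \<Longrightarrow> B 1 2 = 0"
proof -
  obtain s t where st: "C 1 1 * s + C 1 2 * t = 1"
  proof (cases "C 1 1 = 0")
    case True
    then show ?thesis using det_nonzero that[of 0 "1 / C 1 2"] by simp
  next
    case False
    then show ?thesis using that[of "1 / C 1 1" 0] by simp
  qed
  let ?x = "\<lambda>i :: nat. if i = 1 then s else t"
  show "B 1 1 = 0" using component[of 1 ?x] g1[of ?x] st by simp
  show "B 1 2 = 0" if "\<nu> = 0" using component[of 2 ?x] g2[of ?x] st that by simp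
qed

lemma dependent:
  assumes "\<nu> = 0"
  shows "\<exists>y. (\<exists>i\<in>{1..n-1}. y i \<noteq> 0) \<and> (\<forall>k\<in>{1..n}. (\<Sum>i=1..n-1. y i * B i k) = 0)"
proof -
  obtain y where y: "\<exists>i\<in>{1..n-1}. y i \<noteq> 0" "\<forall>k\<in>{3..n}. (\<Sum>i=1..n-1. B i k * y i) = 0"
  proof -
    have "card {3..n} < card {1..n-1}" using n by simp
    then show ?thesis using underdetermined_system[of "{3..n}" "{1..n-1}" "\<lambda>k i. B i k"] that by blast
  qed
  have "B i k = 0" if "i \<in> {1..n-1}" "k \<in> {1, 2}" for i k
    using that \<nu>_cases B_later assms by (cases "i = 1") auto
  then have "(\<Sum>i=1..n-1. y i * B i k) = 0" if "k \<in> {1..n}" for k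
  proof (cases "k \<in> {3..n}")
    case True
    then show ?thesis using y(2) by (simp add: mult.commute)
  next
    case False
    then have "k \<in> {1, 2}" using that by auto
    then show ?thesis using \<open>\<And>i k. i \<in> {1..n-1} \<Longrightarrow> k \<in> {1, 2} \<Longrightarrow> B i k = 0\<close> by simp
  qed
  then show ?thesis using y(1) by blast
qed

text \<open>u spans the kernel of L_2 and v that of L_1, so at p u + q v each of the two powers in
  \<open>two_powers\<close> sees only one summand. The unknown exponents disappear from the
  conclusion; their positivity makes the power of 0 vanish.\<close>

lemma additive_basis:
  obtains u1 u2 v1 v2 where "u1 * v2 - u2 * v1 \<noteq> 0" "C 1 1 * v1 + C 1 2 * v2 = 0"
    "\<And>p q. f (p * u1 + q * v1) (p * u2 + q * v2) = f (p * u1) (p * u2) + f (q * v1) (q * v2)"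
proof -
  obtain a b where f: "\<And>s t. f s t = a * (C 1 1 * s + C 1 2 * t) ^ e 1 + b * (C 2 1 * s + C 2 2 * t) ^ e 2"
    using two_powers by blast
  have e: "e 1 \<noteq> 0" "e 2 \<noteq> 0" using e_pos[of 1] e_pos[of 2] first_two by auto
  \<comment> \<open>The arguments of \<open>that\<close> follow the order of occurrence
    \<open>u1\<close>, \<open>v2\<close>, \<open>u2\<close>, \<open>v1\<close>; thus u = (C_22,
    -C_21) and v = (-C_12, C_11).\<close>
  show ?thesis
  proof (rule that[of "C 2 2" "C 1 1" "- C 2 1" "- C 1 2"])
    fix p q
    have "C 1 1 * (p * C 2 2 + q * - C 1 2) + C 1 2 * (p * - C 2 1 + q * C 1 1) =
        C 1 1 * (p * C 2 2) + C 1 2 * (p * - C 2 1)"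
      "C 2 1 * (p * C 2 2 + q * - C 1 2) + C 2 2 * (p * - C 2 1 + q * C 1 1) =
        C 2 1 * (q * - C 1 2) + C 2 2 * (q * C 1 1)"
      "C 2 1 * (p * C 2 2) + C 2 2 * (p * - C 2 1) = 0"
      "C 1 1 * (q * - C 1 2) + C 1 2 * (q * C 1 1) = 0"
      by (simp_all add: algebra_simps)
    then show "f (p * C 2 2 + q * - C 1 2) (p * - C 2 1 + q * C 1 1) =
        f (p * C 2 2) (p * - C 2 1) + f (q * - C 1 2) (q * C 1 1)"
      unfolding f using e by (simp only: power_0_left) auto
  qed (use det_nonzero in \<open>auto simp: algebra_simps\<close>)
qed

end

section \<open>Sums of powers of linear forms\<close>

text \<open>An n-th finite difference annihilates polynomials of degree below n. The induction
  absorbs one factor i + 1 into the binomial coefficient and expands the remaining power of i + 1 in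
  powers of i.\<close>

lemma alternating_binomial_power_sum:
  fixes k n :: nat
  assumes "k < n"
  shows "(\<Sum>i\<le>n. (-1) ^ i * of_nat (n choose i) * of_nat i ^ k) = (0 :: 'a::comm_ring_1)"
  using assms
proof (induction n arbitrary: k)
  case (Suc n)
  show ?case
  proof (cases k)
    case 0
    then show ?thesis using choose_alternating_sum[of "Suc n", where 'a = 'a] by simp
  next
    case (Suc l)
    have step: "(-1 :: 'a) ^ Suc i * of_nat (Suc n choose Suc i) * of_nat (Suc i) ^ Suc l =
        - of_nat (Suc n) * (\<Sum>m\<le>l. of_nat (l choose m) * ((-1) ^ i * of_nat (n choose i) * of_nat i ^ m))"
      (is "?L = _ * ?R") for i :: nat
    proof -
      have bin: "of_nat (Suc n choose Suc i) * of_nat (Suc i) = (of_nat (Suc n) * of_nat (n choose i) :: 'a)"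
        by (metis Suc_times_binomial_eq mult.commute of_nat_mult)
      have aux: "(-1 * u) * b * (s * t) = - m * (u * c * t)" if "b * s = m * c" for b s m c u t :: 'a
      proof -
        have "(-1 * u) * b * (s * t) = - (u * (b * s) * t)" by (simp add: mult_ac)
        then show ?thesis unfolding that by (simp add: mult_ac)
      qed
      have "?L = - of_nat (Suc n) * ((-1) ^ i * of_nat (n choose i) * of_nat (Suc i) ^ l)"
        unfolding power_Suc by (rule aux[OF bin])
      also have "of_nat (Suc i) ^ l = (\<Sum>m\<le>l. of_nat (l choose m) * of_nat i ^ m :: 'a)"
        using binomial_ring[of "of_nat i :: 'a" 1 l] by (simp add: add.commute)
      finally show ?thesis by (simp only: sum_distrib_left mult.left_commute mult.assoc)
    qed
    \<comment> \<open>The term at i = 0 drops out because the exponent k = l + 1 is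
      positive.\<close>
    have "(\<Sum>i\<le>Suc n. (-1) ^ i * of_nat (Suc n choose i) * of_nat i ^ k) =
        (\<Sum>i\<le>n. (-1) ^ Suc i * of_nat (Suc n choose Suc i) * of_nat (Suc i) ^ Suc l :: 'a)"
      unfolding Suc by (subst sum.atMost_Suc_shift) simp
    also have "\<dots> = - of_nat (Suc n) * (\<Sum>m\<le>l. of_nat (l choose m) *
        (\<Sum>i\<le>n. (-1) ^ i * of_nat (n choose i) * of_nat i ^ m))"
      unfolding step sum_distrib_left[symmetric] by (subst sum.swap) (simp only: sum_distrib_left)
    also have "\<dots> = 0"
      using Suc.IH Suc.prems Suc by (simp add: sum.neutral)
    finally show ?thesis .
  qed
qed simp

text \<open>Expanding in powers of i, the previous lemma leaves only i^d, and its coefficient z^d no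
  longer contains x.\<close>

lemma alternating_power_sum_translate:
  fixes x y z :: "'a::comm_ring_1"
  shows "(\<Sum>i\<le>d. (-1) ^ i * of_nat (d choose i) * (x + of_nat i * z) ^ d) =
    (\<Sum>i\<le>d. (-1) ^ i * of_nat (d choose i) * (y + of_nat i * z) ^ d)"
proof -
  have "(\<Sum>i\<le>d. (-1) ^ i * of_nat (d choose i) * (x + of_nat i * z) ^ d) =
      (\<Sum>i\<le>d. (-1) ^ i * of_nat (d choose i) * of_nat i ^ d) * z ^ d" for x :: 'a
  proof -
    have "(\<Sum>i\<le>d. (-1) ^ i * of_nat (d choose i) * (x + of_nat i * z) ^ d) =
      (\<Sum>i\<le>d. \<Sum>k\<le>d. of_nat (d choose k) * z ^ k * x ^ (d - k) * ((-1) ^ i * of_nat (d choose i) * of_nat i ^ k))"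
      by (subst add.commute, subst binomial_ring)
        (simp add: sum_distrib_left power_mult_distrib mult_ac)
    also have "\<dots> = (\<Sum>k\<le>d. of_nat (d choose k) * z ^ k * x ^ (d - k) * (\<Sum>i\<le>d. (-1) ^ i * of_nat (d choose i) * of_nat i ^ k))"
      by (subst sum.swap) (simp add: sum_distrib_left)
    also have "\<dots> = (\<Sum>k\<in>{d}. of_nat (d choose k) * z ^ k * x ^ (d - k) * (\<Sum>i\<le>d. (-1) ^ i * of_nat (d choose i) * of_nat i ^ k))"
      by (intro sum.mono_neutral_right) (auto simp: alternating_binomial_power_sum)
    finally show ?thesis by simp
  qed
  then show ?thesis by simp
qed

section \<open>Power sums over roots of unity\<close>

lemma sum_powers_root_of_unity:
  fixes z :: "'a::field"
  assumes z: "primitive_root_of_unity d z" and k: "k \<in> {1..d}"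
  shows "(\<Sum>i<d. z ^ (i * k)) = (if k = d then of_nat d else 0)"
proof (cases "k = d")
  case True
  then show ?thesis using z by (simp add: primitive_root_of_unity_def power_mult mult.commute[of _ d])
next
  case False
  then have ne: "z ^ k \<noteq> 1" using z k by (auto simp: primitive_root_of_unity_def)
  have "(z ^ k - 1) * (\<Sum>i<d. (z ^ k) ^ i) = (z ^ k) ^ d - 1"
    by (simp add: power_diff_1_eq)
  also have "(z ^ k) ^ d = (z ^ d) ^ k" by (simp add: power_mult[symmetric] mult.commute)
  finally have "(\<Sum>i<d. (z ^ k) ^ i) = 0"
    using ne z by (simp add: primitive_root_of_unity_def)
  then show ?thesis using False by (simp add: power_mult[symmetric] mult.commute)
qed

lemma primitive_root_of_unity_inj:
  fixes z :: "'a::field"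
  assumes z: "primitive_root_of_unity d z"
  shows "inj_on (\<lambda>i. z ^ i) {..<d}"
proof -
  have aux: False if "i < j" "j < d" "z ^ i = z ^ j" for i j
  proof -
    have "z \<noteq> 0" using z by (auto simp: primitive_root_of_unity_def power_0_left)
    moreover have "z ^ j = z ^ i * z ^ (j - i)" using that(1) by (simp add: power_add[symmetric])
    ultimately have "z ^ (j - i) = 1" using that(3) by simp
    moreover have "j - i \<in> {1..<d}" using that(1,2) by auto
    ultimately show False using z by (auto simp: primitive_root_of_unity_def)
  qed
  show ?thesis by (rule inj_onI) (metis aux lessThan_iff linorder_neqE_nat)
qed

text \<open>The sum over i acts as a filter on the binomial expansion: x^k y^(d-k) receives the sum
  of z^(i(k+1)), which for k <= d is nonzero only at k = d - 1. One factor d comes from that sum,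
  the other from the binomial coefficient.\<close>

lemma root_of_unity_power_sum:
  fixes z :: "'a::field" and x y :: "'a mpoly"
  assumes z: "primitive_root_of_unity d z" and d: "d \<ge> 2"
  shows "(\<Sum>i<d. Const (z ^ i) * (Const (z ^ i) * x + y) ^ d) = of_nat (d ^ 2) * (x ^ (d - 1) * y)"
proof -
  have "(\<Sum>i<d. Const (z ^ i) * (Const (z ^ i) * x + y) ^ d) =
      (\<Sum>i<d. \<Sum>k\<le>d. of_nat (d choose k) * x ^ k * y ^ (d - k) * Const (z ^ (i * Suc k)))"
    by (subst binomial_ring)
      (simp add: sum_distrib_left power_mult_distrib Const.hom_power Const.hom_mult power_mult power_add mult_ac)
  also have "\<dots> = (\<Sum>k\<le>d. of_nat (d choose k) * x ^ k * y ^ (d - k) * Const (\<Sum>i<d. z ^ (i * Suc k)))"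
    by (subst sum.swap) (simp add: sum_distrib_left Const.hom_sum)
  also have "\<dots> = (\<Sum>k\<in>{d - 1}. of_nat (d choose k) * x ^ k * y ^ (d - k) * Const (\<Sum>i<d. z ^ (i * Suc k)))"
  proof (rule sum.mono_neutral_right)
    show "\<forall>k\<in>{..d} - {d - 1}. of_nat (d choose k) * x ^ k * y ^ (d - k) * Const (\<Sum>i<d. z ^ (i * Suc k)) = 0"
    proof
      fix k assume k: "k \<in> {..d} - {d - 1}"
      have "(\<Sum>i<d. z ^ (i * Suc k)) = 0"
      proof (cases "k = d")
        \<comment> \<open>For k = d the exponent k + 1 exceeds the range of
          \<open>sum_powers_root_of_unity\<close>; z^d = 1 reduces it to 1, where the sum vanishes
          because d >= 2.\<close>
        case True
        have zd: "z ^ d = 1" using z by (simp add: primitive_root_of_unity_def)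
        have "z ^ (i * Suc d) = z ^ (i * 1)" for i
        proof -
          have "z ^ (i * Suc d) = z ^ i * (z ^ d) ^ i"
            by (simp add: power_add power_mult[symmetric] mult.commute)
          then show ?thesis using zd by simp
        qed
        then show ?thesis using sum_powers_root_of_unity[OF z, of 1] d True by simp
      next
        case False
        then show ?thesis using sum_powers_root_of_unity[OF z, of "Suc k"] k by (auto simp del: mult_Suc_right)
      qed
      then show "of_nat (d choose k) * x ^ k * y ^ (d - k) * Const (\<Sum>i<d. z ^ (i * Suc k)) = 0" by simp
    qed
  qed auto
  also have "\<dots> = of_nat d * x ^ (d - 1) * y * of_nat d"
  proof -
    have "(d choose (d - 1)) = d" using d binomial_symmetric[of 1 d] by simp
    then show ?thesis
      using d sum_powers_root_of_unity[OF z, of d] by (simp add: Const.hom_of_nat del: mult_Suc_right)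
  qed
  finally show ?thesis by (simp add: power2_eq_square mult_ac)
qed

text \<open>A field of characteristic zero is infinite, so a polynomial function that is constant in
  r comes from a constant polynomial, and the coefficients of r^j can be compared.\<close>

lemma coeff_power_sum:
  fixes \<alpha> \<beta> y :: "'i \<Rightarrow> 'a::field_char_0"
  assumes eq: "\<And>r. (\<Sum>i\<in>I. y i * (\<alpha> i + \<beta> i * r) ^ d) = c" and j: "j \<le> d"
  shows "of_nat (d choose j) * (\<Sum>i\<in>I. y i * \<beta> i ^ j * \<alpha> i ^ (d - j)) = (if j = 0 then c else 0)"
proof -
  define P where "P = (\<Sum>i\<in>I. Polynomial.smult (y i) ([:\<alpha> i, \<beta> i:] ^ d))"
  have "poly P = poly [:c:]"
  proof
    fix r
    show "poly P r = poly [:c:] r"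
      using eq[of r] by (simp add: P_def poly_sum mult.commute)
  qed
  then have "P = [:c:]" by (simp only: poly_eq_poly_eq_iff)
  moreover have "coeff P j = of_nat (d choose j) * (\<Sum>i\<in>I. y i * \<beta> i ^ j * \<alpha> i ^ (d - j))"
    using j by (simp add: P_def coeff_sum coeff_linear_poly_power sum_distrib_left mult_ac)
  ultimately show ?thesis by (cases j) (auto simp: coeff_pCons)
qed

lemma coeff_power_sum_zero:
  fixes \<alpha> \<beta> y :: "'i \<Rightarrow> 'a::field_char_0"
  assumes eq: "\<And>r. (\<Sum>i\<in>I. y i * (\<alpha> i + \<beta> i * r) ^ d) = c" and j: "j \<le> d" "j \<noteq> 0 \<or> c = 0"
  shows "(\<Sum>i\<in>I. y i * \<beta> i ^ j * \<alpha> i ^ (d - j)) = 0"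
  using coeff_power_sum[OF eq j(1)] j by (auto split: if_splits)

section \<open>Constructing representations\<close>

lemma finsum_vec_smult_index:
  assumes "finite A" "k < n" "\<And>i. i \<in> A \<Longrightarrow> v i \<in> carrier_vec n"
  shows "finsum_vec TYPE('b::comm_ring_1) n (\<lambda>i. p i \<cdot>\<^sub>v v i) A $ k = (\<Sum>i\<in>A. p i * v i $ k)"
proof -
  have "finsum_vec TYPE('b) n (\<lambda>i. p i \<cdot>\<^sub>v v i) A $ k = (\<Sum>i\<in>A. (p i \<cdot>\<^sub>v v i) $ k)"
    using assms by (intro index_finsum_vec) auto
  also have "\<dots> = (\<Sum>i\<in>A. p i * v i $ k)"
    by (intro sum.cong refl) (simp add: assms(2) carrier_vecD[OF assms(3)])
  finally show ?thesis .
qed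

lemma finsum_vec_smult_carrier:
  assumes "\<And>i. i \<in> A \<Longrightarrow> v i \<in> carrier_vec n"
  shows "finsum_vec TYPE('b::comm_ring_1) n (\<lambda>i. p i \<cdot>\<^sub>v v i) A \<in> carrier_vec n"
  using assms by (intro finsum_vec_closed) auto

lemma sum_pred: "(\<Sum>k=1..n. F (k - 1)) = (\<Sum>k<n::nat. F k)"
  by (rule sum.reindex_bij_witness[of _ Suc "\<lambda>k. k - 1"]) auto

lemma scalar_prod_sum: "v \<in> carrier_vec n \<Longrightarrow> u \<bullet> v = (\<Sum>k<n. u $ k * v $ k)"
  by (simp add: scalar_prod_def lessThan_atLeast0)

lemma star_rep_index:
  assumes "star_rep n d N b c e (map_of_polys n H)" "k \<in> {1..n}"
  shows "H k = (\<Sum>i=1..N. lin_form (c i) ^ e i * Const (b i $ (k - 1)))"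
proof -
  have b: "b i \<in> carrier_vec n" if "i \<in> {1..N}" for i using assms that by (auto simp: star_rep_def)
  have "H k = map_of_polys n H $ (k - 1)" using assms(2) by (cases k) (simp_all add: map_of_polys_def)
  also have "\<dots> = (\<Sum>i=1..N. lin_form (c i) ^ e i * map_vec Const (b i) $ (k - 1))"
  proof -
    have "map_of_polys n H = finsum_vec TYPE('a mpoly) n (\<lambda>i. lin_form (c i) ^ e i \<cdot>\<^sub>v map_vec Const (b i)) {1..N}"
      using assms(1) by (simp add: star_rep_def)
    then show ?thesis using assms(2) b by (simp only:) (intro finsum_vec_smult_index, auto)
  qed
  also have "\<dots> = (\<Sum>i=1..N. lin_form (c i) ^ e i * Const (b i $ (k - 1)))"
    using assms(2) by (intro sum.cong refl) (simp add: carrier_vecD[OF b] less_eq_Suc_le)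
  finally show ?thesis .
qed

lemma star_repI:
  assumes "\<And>i. i \<in> {1..N} \<Longrightarrow> b i \<in> carrier_vec n \<and> c i \<in> carrier_vec n \<and> e i \<in> {1..d}"
    and "\<And>i j. i \<in> {1..N} \<Longrightarrow> j \<in> {1..i} \<Longrightarrow> c j \<bullet> b i = 0"
    and H: "\<And>k. k \<in> {1..n} \<Longrightarrow> H k = (\<Sum>i=1..N. lin_form (c i) ^ e i * Const (b i $ (k - 1)))"
  shows "star_rep n d N b c e (map_of_polys n H)"
proof -
  let ?F = "finsum_vec TYPE('a mpoly) n (\<lambda>i. lin_form (c i) ^ e i \<cdot>\<^sub>v map_vec Const (b i)) {1..N}"
  have F: "?F \<in> carrier_vec n" using assms(1) by (intro finsum_vec_smult_carrier) auto
  have "map_of_polys n H = ?F"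
  proof (rule eq_vecI)
    show "dim_vec (map_of_polys n H) = dim_vec ?F" using F by (simp add: map_of_polys_def)
    fix k assume "k < dim_vec ?F"
    then have k: "k < n" using F by simp
    have "?F $ k = (\<Sum>i=1..N. lin_form (c i) ^ e i * map_vec Const (b i) $ k)"
      using k assms(1) by (intro finsum_vec_smult_index) auto
    also have "\<dots> = (\<Sum>i=1..N. lin_form (c i) ^ e i * Const (b i $ k))"
      using k by (intro sum.cong refl) (simp add: carrier_vecD[OF conjunct1[OF assms(1)]])
    finally show "map_of_polys n H $ k = ?F $ k" using k H[of "Suc k"] by (simp add: map_of_polys_def)
  qed
  then show ?thesis using assms(1,2) by (auto simp: star_rep_def)
qed

text \<open>Substituting T' x into the linear form with coefficients u gives the linear form with
  coefficients T'^t u. So it suffices that every row of T combines the components of H to a d-th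
  power of a linear form.\<close>

lemma power_linear_conjugate:
  fixes T T' :: "'a::field mat" and H :: "nat \<Rightarrow> 'a mpoly"
  assumes T: "T \<in> carrier_mat n n" and T': "T' \<in> carrier_mat n n"
    and rows: "\<And>r. r < n \<Longrightarrow> \<exists>u \<in> carrier_vec n. (\<Sum>k<n. Const (T $$ (r, k)) * H (Suc k)) = lin_form u ^ d"
  shows "power_linear n d
    (map_mat Const T *\<^sub>v subst_map (map_of_polys n H) (map_mat Const T' *\<^sub>v var_vec n))"
    (is "power_linear n d ?G")
proof -
  obtain u where u: "\<And>r. r < n \<Longrightarrow> u r \<in> carrier_vec n"
    "\<And>r. r < n \<Longrightarrow> (\<Sum>k<n. Const (T $$ (r, k)) * H (Suc k)) = lin_form (u r) ^ d"
  proof -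
    have "\<forall>r\<in>{..<n}. \<exists>u. u \<in> carrier_vec n \<and> (\<Sum>k<n. Const (T $$ (r, k)) * H (Suc k)) = lin_form u ^ d"
      using rows by blast
    from bchoice[OF this] obtain u where u: "\<forall>r\<in>{..<n}. u r \<in> carrier_vec n \<and>
        (\<Sum>k<n. Const (T $$ (r, k)) * H (Suc k)) = lin_form (u r) ^ d"
      by (elim exE)
    show ?thesis
    proof (rule that)
      fix r assume "r < n"
      then have "r \<in> {..<n}" by simp
      from bspec[OF u this] show "u r \<in> carrier_vec n"
        "(\<Sum>k<n. Const (T $$ (r, k)) * H (Suc k)) = lin_form (u r) ^ d" by (rule conjunct1, rule conjunct2)
    qed
  qed
  \<comment> \<open>This is T'^t u; the shift reconciles rows counted from 0 with the vectors a_1,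
    ..., a_n.\<close>
  define a where "a i = vec n (\<lambda>l. \<Sum>j<n. u (i - 1) $ j * T' $$ (j, l))" for i
  let ?v = "map_mat Const T' *\<^sub>v var_vec n"
  let ?s = "\<lambda>i. ?v $ (i - 1)"
  have v: "?v $ j = (\<Sum>l<n. Const (T' $$ (j, l)) * var (Suc l))" if "j < n" for j
    using that T' by (simp add: scalar_prod_def var_vec_def lessThan_atLeast0)
  have G_dim: "dim_vec ?G = n" using T by simp
  have G: "?G $ r = lin_form (a (Suc r)) ^ d" if r: "r < n" for r
  proof -
    have "?G $ r = (\<Sum>k<n. Const (T $$ (r, k)) * subst_poly ?s (H (Suc k)))"
      using r T T' by (simp add: scalar_prod_def subst_map_def map_of_polys_def lessThan_atLeast0)
    also have "\<dots> = subst_poly ?s (\<Sum>k<n. Const (T $$ (r, k)) * H (Suc k))"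
      by (simp add: subst_poly.hom_sum subst_poly.hom_mult)
    also have "\<dots> = subst_poly ?s (lin_form (u r)) ^ d" by (simp add: u(2)[OF r] subst_poly.hom_power)
    also have "subst_poly ?s (lin_form (u r)) = (\<Sum>j<n. Const (u r $ j) * ?v $ j)"
      using u(1)[OF r] by (simp add: subst_poly_lin_form)
    also have "\<dots> = (\<Sum>j<n. \<Sum>l<n. Const (u r $ j * T' $$ (j, l)) * var (Suc l))"
      by (intro sum.cong refl) (simp add: v sum_distrib_left Const.hom_mult mult.assoc del: index_mult_mat_vec)
    also have "\<dots> = lin_form (a (Suc r))"
      by (subst sum.swap) (simp add: lin_form_eq_sum a_def Const.hom_sum sum_distrib_right)
    finally show ?thesis .
  qed
  have a: "a i \<in> carrier_vec n" for i by (simp add: a_def)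
  let ?F = "finsum_vec TYPE('a mpoly) n (\<lambda>i. lin_form (a i) ^ d \<cdot>\<^sub>v unit_vec n (i - 1)) {1..n}"
  have F: "?F \<in> carrier_vec n" by (rule finsum_vec_smult_carrier) simp
  have "?G = ?F"
  proof (rule eq_vecI)
    show "dim_vec ?G = dim_vec ?F" using F G_dim by simp
    fix r assume "r < dim_vec ?F"
    then have r: "r < n" using F by simp
    have "?F $ r = (\<Sum>i=1..n. lin_form (a i) ^ d * unit_vec n (i - 1) $ r)"
      using r by (intro finsum_vec_smult_index) auto
    also have "\<dots> = (\<Sum>i\<in>{Suc r}. lin_form (a i) ^ d * unit_vec n (i - 1) $ r)"
      using r by (intro sum.mono_neutral_right) (auto split: if_splits)
    finally show "?G $ r = ?F $ r" using G r by (simp del: index_mult_mat_vec)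
  qed
  moreover have "?G \<in> poly_maps n"
    unfolding poly_maps_def
  proof (intro CollectI conjI allI impI)
    show "?G \<in> carrier_vec n" by (rule carrier_vecI) (rule G_dim)
    show "?G $ r \<in> poly_ring n" if "r < n" for r
      unfolding G[OF that] by (intro poly_ring_power poly_ring_lin_form a)
  qed
  ultimately show ?thesis unfolding power_linear_def using a by blast
qed

lemma upper_triangular_inverse:
  fixes T :: "'a::field mat"
  assumes T: "T \<in> carrier_mat n n" and "upper_triangular T" and "\<And>r. r < n \<Longrightarrow> T $$ (r, r) \<noteq> 0"
  obtains T' where "T' \<in> carrier_mat n n" "inverts_mat T T'" "inverts_mat T' T"
proof -
  have "det T = prod_list (diag_mat T)" using assms by (intro det_upper_triangular)
  then have "det T \<noteq> 0" using assms by (auto simp: prod_list_zero_iff diag_mat_def)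
  from det_non_zero_imp_unit[OF T this, of "()"]
  obtain T' where "T' \<in> carrier_mat n n" "T * T' = 1\<^sub>m n" "T' * T = 1\<^sub>m n"
    by (auto simp: Units_def ring_mat_simps)
  then show ?thesis using that T by (auto simp: inverts_mat_def)
qed

text \<open>The vectors b_i of all representations constructed below: the first \<open>m\<close>
  feed powers of binary forms into H_2 and H_3, and each later one serves a single component that is
  itself a power. As entries count from 0, index i = m + 1 gives the vector usually called
  e_4.\<close>

definition layer_vec :: "nat \<Rightarrow> nat \<Rightarrow> (nat \<Rightarrow> 'a) \<Rightarrow> (nat \<Rightarrow> 'a) \<Rightarrow> nat \<Rightarrow> 'a::field vec" where
  "layer_vec n m q r i = (if i \<le> m then vec3 n 0 (q i) (r i) else unit_vec n (i - m + 2))"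

text \<open>The family $q_i, \alpha_i, \beta_i$ writes $H_3$ as a sum of powers of binary linear forms, and
  $w$ gives the combination of $H_3, \dots, H_{2d+2}$ that is a power of a linear form.\<close>

locale special_map =
  fixes d :: nat and \<nu> :: "'a::field_char_0" and H :: "nat \<Rightarrow> 'a mpoly" and f :: "'a \<Rightarrow> 'a \<Rightarrow> 'a"
    and a b c :: "nat \<Rightarrow> 'a" and m :: nat and q \<alpha> \<beta> w :: "nat \<Rightarrow> 'a" and l1 l2 l3 :: 'a
  assumes d: "2 \<le> d"
    and H1: "H 1 = 0"
    and H2: "H 2 = Const \<nu> * var 1 ^ d"
    and H3: "eval_at x (H 3) = f (x 1) (x 2)"
    and H_power: "k \<in> {4..2*d+2} \<Longrightarrow>
      H k = (Const (a k) * var 1 + Const (b k) * var 2 + Const (c k) * var 3) ^ d"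
    and H3_sum: "H 3 = (\<Sum>i=1..m. Const (q i) * (Const (\<alpha> i) * var 1 + Const (\<beta> i) * var 2) ^ d)"
    and indep: "(\<And>s t r. (\<Sum>k=4..2*d+2. y k * (a k * s + b k * t + c k * r) ^ d) =
      (\<Sum>k=4..2*d+2. y k * (a k * s + b k * t) ^ d)) \<Longrightarrow> k \<in> {4..2*d+2} \<Longrightarrow> y k = 0"
    and no_period: "(\<And>s t. f (s + u) (t + v) = f s t) \<Longrightarrow> u = 0 \<and> v = 0"
    and combination: "(\<Sum>k=3..2*d+2. Const (w k) * H k) =
      (Const l1 * var 1 + Const l2 * var 2 + Const l3 * var 3) ^ d" and w3: "w 3 \<noteq> 0"
begin

lemma H2_eq_0_iff: "H 2 = 0 \<longleftrightarrow> \<nu> = 0"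
proof
  assume "H 2 = 0"
  then have "eval_at (\<lambda>_. 1) (H 2) = 0" by simp
  then show "\<nu> = 0" by (simp add: H2 eval_at.hom_mult eval_at.hom_power)
qed (simp add: H2)

lemma poly_maps: 
  assumes n: "3 \<le> n" "n \<le> 2 * d + 2"
  shows "map_of_polys n H \<in> poly_maps n"
proof -
  have "H k \<in> poly_ring n" if k: "k \<in> {1..n}" for k
  proof -
    consider "k = 1" | "k = 2" | "k = 3" | "k \<in> {4..2*d+2}" using k n by fastforce
    then show ?thesis
    proof cases
      case 1
      then show ?thesis by (simp add: H1[simplified])
    next
      case 2
      then show ?thesis using n unfolding 2 H2 by (intro poly_ring_intros poly_ring_Const) auto
    next
      case 3
      then show ?thesis using n unfolding 3 H3_sum by (intro poly_ring_intros poly_ring_Const) auto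
    next
      case 4
      then show ?thesis using n unfolding H_power[OF 4] by (intro poly_ring_intros poly_ring_Const) auto
    qed
  qed
  then show ?thesis by (auto simp: poly_maps_def map_of_polys_def)
qed

text \<open>All c_j live on x_1, x_2, x_3 and are thus orthogonal to the unit vectors used for i >
  p. Among the first p layers, c_j has no x_3 entry and b_i no x_1 entry, so only the product at x_2
  must vanish; this is the hypothesis \<open>orth\<close>.\<close>

lemma layered_star_rep:
  assumes n: "3 \<le> n" "n \<le> 2 * d + 2"
    and H2': "H 2 = (\<Sum>i=1..p. Const (q2 i) * (Const (\<alpha>' i) * var 1 + Const (\<beta>' i) * var 2) ^ d)"
    and H3': "H 3 = (\<Sum>i=1..p. Const (q3 i) * (Const (\<alpha>' i) * var 1 + Const (\<beta>' i) * var 2) ^ d)"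
    and orth: "\<And>i j. i \<in> {1..p} \<Longrightarrow> j \<in> {1..i} \<Longrightarrow> \<beta>' j * q2 i = 0"
  shows "\<exists>c. star_rep n d (p + (n - 3)) (layer_vec n p q2 q3) c (\<lambda>_. d) (map_of_polys n H)"
proof
  let ?b = "layer_vec n p q2 q3 :: nat \<Rightarrow> 'a vec"
  \<comment> \<open>Past the first \<open>p\<close> layers, index i belongs to the component
    H_(i-p+3), starting with H_4.\<close>
  let ?c = "\<lambda>i. if i \<le> p then vec3 n (\<alpha>' i) (\<beta>' i) 0
    else vec3 n (a (i - p + 3)) (b (i - p + 3)) (c (i - p + 3))"
  show "star_rep n d (p + (n - 3)) ?b ?c (\<lambda>_. d) (map_of_polys n H)"
  proof (rule star_repI)
    show "?b i \<in> carrier_vec n \<and> ?c i \<in> carrier_vec n \<and> d \<in> {1..d}" for i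
      using d by (auto simp: layer_vec_def)
  next
    fix i j assume i: "i \<in> {1..p + (n - 3)}" and j: "j \<in> {1..i}"
    show "?c j \<bullet> ?b i = 0"
    proof (cases "i \<le> p")
      case True
      have "?c j \<bullet> ?b i = (\<Sum>k<n. vec3 n (\<alpha>' j) (\<beta>' j) 0 $ k * vec3 n 0 (q2 i) (q3 i) $ k)"
        using True j by (simp add: layer_vec_def scalar_prod_sum[OF vec3_carrier])
      also have "\<dots> = \<beta>' j * q2 i"
        using n by (subst sum_vec3) (auto simp: vec3_def)
      finally show ?thesis using orth[of i j] True i j by simp
    next
      case False
      then have "?c j \<bullet> ?b i = ?c j $ (i - p + 2)"
        using i by (auto simp: layer_vec_def intro!: scalar_prod_right_unit)
      also have "\<dots> = 0" using False i by (auto simp: vec3_def)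
      finally show ?thesis .
    qed
  next
    fix k assume k: "k \<in> {1..n}"
    let ?t = "\<lambda>i. lin_form (?c i) ^ d * Const (?b i $ (k - 1))"
    have split: "(\<Sum>i=1..p + (n - 3). ?t i) = (\<Sum>i=1..p. ?t i) + (\<Sum>i=p+1..p + (n - 3). ?t i)"
      by (rule sum.ub_add_nat) simp
    have lo: "(\<Sum>i=1..p. ?t i) = (\<Sum>i=1..p. Const (vec3 n 0 (q2 i) (q3 i) $ (k - 1)) *
        (Const (\<alpha>' i) * var 1 + Const (\<beta>' i) * var 2) ^ d)"
      using n by (intro sum.cong refl) (auto simp: layer_vec_def lin_form_vec3 mult.commute)
    have hi: "(\<Sum>i=p+1..p + (n - 3). ?t i) = (\<Sum>i=p+1..p + (n - 3). lin_form (?c i) ^ d *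
        Const (if k - 1 = i - p + 2 then 1 else 0))"
    proof (intro sum.cong refl)
      fix i assume i: "i \<in> {p+1..p + (n - 3)}"
      have "unit_vec n (i - p + 2) $ (k - 1) = (if k - 1 = i - p + 2 then 1 else 0 :: 'a)"
        using i k by (subst index_unit_vec) auto
      then show "?t i = lin_form (?c i) ^ d * Const (if k - 1 = i - p + 2 then 1 else 0)"
        using i by (simp add: layer_vec_def)
    qed
    have low: "(\<Sum>i=1..p + (n - 3). ?t i) = (\<Sum>i=1..p. Const (vec3 n 0 (q2 i) (q3 i) $ (k - 1)) *
        (Const (\<alpha>' i) * var 1 + Const (\<beta>' i) * var 2) ^ d)" if "k \<le> 3"
    proof -
      have "(\<Sum>i=p+1..p + (n - 3). ?t i) = 0"
        unfolding hi using that by (intro sum.neutral) auto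
      then show ?thesis by (simp only: split lo add_0_right)
    qed
    consider "k = 1" | "k = 2" | "k = 3" | "k \<in> {4..n}" using k by fastforce
    then show "H k = (\<Sum>i=1..p + (n - 3). ?t i)"
    proof cases
      case 1
      show ?thesis unfolding low[OF eq_refl[OF 1, THEN order_trans, of 3, simplified]]
        using n 1 by (simp add: H1[simplified] vec3_def)
    next
      case 2
      show ?thesis unfolding low[OF eq_refl[OF 2, THEN order_trans, of 3, simplified]]
        using n 2 by (simp add: H2' vec3_def)
    next
      case 3
      show ?thesis unfolding low[OF eq_refl[OF 3]]
        using n 3 by (simp add: H3' vec3_def)
    next
      case 4
      have "vec3 n 0 u v $ (k - 1) = 0" for u v :: 'a
      proof -
        have "k - 1 < n" "k - 1 \<noteq> 0" "k - 1 \<noteq> 1" "k - 1 \<noteq> 2" using 4 by auto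
        then show ?thesis unfolding vec3_def by (subst index_vec) simp_all
      qed
      then have "(\<Sum>i=1..p. ?t i) = 0" unfolding lo by simp
      moreover have "(\<Sum>i=p+1..p + (n - 3). ?t i) = (\<Sum>i\<in>{p + (k - 3)}. lin_form (?c i) ^ d *
        Const (if k - 1 = i - p + 2 then 1 else 0))"
        unfolding hi using 4 by (intro sum.mono_neutral_right) auto
      moreover have "\<dots> = lin_form (vec3 n (a k) (b k) (c k)) ^ d" using 4 by auto
      ultimately show ?thesis
        unfolding split using 4 n by (simp add: H_power lin_form_vec3)
    qed
  qed
qed

text \<open>One layer x_1^d for H_2, then m layers for H_3. The first form has no x_2 entry and the
  later b_i have none either, so the orthogonality condition of \<open>layered_star_rep\<close>
  holds.\<close>

lemma star1: 
  assumes n: "3 \<le> n" "n \<le> 2 * d + 2"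
  shows "star1 n d (map_of_polys n H)"
proof -
  let ?\<alpha> = "\<lambda>i. if i = 1 then 1 else \<alpha> (i - 1)" and ?\<beta> = "\<lambda>i. if i = 1 then 0 else \<beta> (i - 1)"
  let ?q2 = "\<lambda>i. if i = 1 then \<nu> else 0" and ?q3 = "\<lambda>i. if i = 1 then 0 else q (i - 1)"
  have split: "(\<Sum>i=1..Suc m. F i) = F 1 + (\<Sum>i=1..m. F (Suc i))" for F :: "nat \<Rightarrow> 'a mpoly"
    by (subst sum.atLeast_Suc_atMost, simp, subst sum.shift_bounds_cl_Suc_ivl, simp)
  have "\<exists>c. star_rep n d (Suc m + (n - 3)) (layer_vec n (Suc m) ?q2 ?q3) c (\<lambda>_. d) (map_of_polys n H)"
  proof (rule layered_star_rep[OF n, where \<alpha>' = ?\<alpha> and \<beta>' = ?\<beta>])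
    show "H 2 = (\<Sum>i=1..Suc m. Const (?q2 i) * (Const (?\<alpha> i) * var 1 + Const (?\<beta> i) * var 2) ^ d)"
      unfolding split by (simp add: H2)
    show "H 3 = (\<Sum>i=1..Suc m. Const (?q3 i) * (Const (?\<alpha> i) * var 1 + Const (?\<beta> i) * var 2) ^ d)"
      unfolding split by (simp add: H3_sum)
  qed auto
  then show ?thesis unfolding star1_def by blast
qed

lemma power_linear:
  "\<exists>T T' :: 'a mat.
     T \<in> carrier_mat (2 * d + 2) (2 * d + 2) \<and> T' \<in> carrier_mat (2 * d + 2) (2 * d + 2) \<and>
     inverts_mat T T' \<and> inverts_mat T' T \<and>
     power_linear (2 * d + 2) d
       (map_mat Const T *\<^sub>v
          subst_map (map_of_polys (2 * d + 2) H) (map_mat Const T' *\<^sub>v var_vec (2 * d + 2)))"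
proof -
  let ?n = "2 * d + 2"
  have n: "3 \<le> ?n" using d by simp
  \<comment> \<open>Row 2, counted from 0, replaces H_3 by the combination \<open>w\<close>, which
    involves no earlier component, so T is upper triangular with pivot \<open>w 3\<close>. Row 1
    divides by a nonzero \<nu>, since \<nu> need not have a d-th root in K.\<close>
  define T where "T = mat ?n ?n (\<lambda>(r, k). if r = 2 then (if k < 2 then 0 else w (k + 1))
    else if r = k then (if r = 1 \<and> \<nu> \<noteq> 0 then inverse \<nu> else 1) else 0)"
  have T: "T \<in> carrier_mat ?n ?n" by (simp add: T_def)
  obtain T' where T': "T' \<in> carrier_mat ?n ?n" "inverts_mat T T'" "inverts_mat T' T"
  proof (rule upper_triangular_inverse[OF T])
    show "upper_triangular T" by (auto simp: T_def)
    show "T $$ (r, r) \<noteq> 0" if "r < ?n" for r using that w3 by (auto simp: T_def numeral_3_eq_3 numeral_2_eq_2)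
  qed
  have "\<exists>u \<in> carrier_vec ?n. (\<Sum>k<?n. Const (T $$ (r, k)) * H (Suc k)) = lin_form u ^ d"
    if r: "r < ?n" for r
  proof (cases "r = 2")
    case True
    have "(\<Sum>k<?n. Const (T $$ (r, k)) * H (Suc k)) = (\<Sum>k=2..<?n. Const (T $$ (r, k)) * H (Suc k))"
      using True n by (intro sum.mono_neutral_right) (auto simp: T_def)
    also have "\<dots> = (\<Sum>k=2..<?n. Const (w (k + 1)) * H (k + 1))"
      using True by (intro sum.cong) (auto simp: T_def)
    also have "\<dots> = (\<Sum>k=3..?n. Const (w k) * H k)"
      by (rule sum.reindex_bij_witness[of _ "\<lambda>k. k - 1" Suc]) auto
    also have "\<dots> = lin_form (vec3 ?n l1 l2 l3) ^ d"
      using n by (simp only: combination lin_form_vec3)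
    finally show ?thesis using vec3_carrier by blast
  next
    case False
    have "(\<Sum>k<?n. Const (T $$ (r, k)) * H (Suc k)) = (\<Sum>k\<in>{r}. Const (T $$ (r, k)) * H (Suc k))"
      using False r by (intro sum.mono_neutral_right) (auto simp: T_def)
    then have sum: "(\<Sum>k<?n. Const (T $$ (r, k)) * H (Suc k)) = Const (T $$ (r, r)) * H (Suc r)" by simp
    consider "r = 0" | "r = 1" | "Suc r \<in> {4..?n}" using False r by fastforce
    then show ?thesis
    proof cases
      case 1
      then have "Const (T $$ (r, r)) * H (Suc r) = lin_form (vec3 ?n 0 0 0) ^ d"
        using n d by (simp add: H1[simplified] lin_form_vec3)
      then show ?thesis using vec3_carrier sum by metis
    next
      case 2
      then have "Const (T $$ (r, r)) * H (Suc r) = Const (T $$ (r, r) * \<nu>) * var 1 ^ d"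
        using H2 by (simp add: numeral_2_eq_2 Const.hom_mult mult.assoc)
      also have "T $$ (r, r) * \<nu> = (if \<nu> = 0 then 0 else 1)" using 2 n by (simp add: T_def)
      also have "Const (if \<nu> = 0 then 0 else 1) * var 1 ^ d = lin_form (vec3 ?n (if \<nu> = 0 then 0 else 1) 0 0) ^ d"
        using n d by (simp add: lin_form_vec3 power_0_left)
      finally show ?thesis using vec3_carrier sum by metis
    next
      case 3
      then have "T $$ (r, r) = 1" by (auto simp: T_def)
      then have "Const (T $$ (r, r)) * H (Suc r) = lin_form (vec3 ?n (a (Suc r)) (b (Suc r)) (c (Suc r))) ^ d"
        using H_power[OF 3] n by (simp add: lin_form_vec3)
      then show ?thesis using vec3_carrier sum by metis
    qed
  qed
  then show ?thesis using power_linear_conjugate[OF T T'(1)] T T' by blast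
qed

section \<open>Restrictions on representations of H with n - 1 powers\<close>

lemma few_powers:
  assumes n: "3 \<le> n" "n \<le> 2 * d + 2" and star: "star_rep n d (n - 1) B C e (map_of_polys n H)"
  shows "few_powers n d \<nu> f (\<lambda>k x. eval_at x (H k)) (\<lambda>i k. B i $ (k - 1)) (\<lambda>i j. C i $ (j - 1)) e"
proof
  have B: "i \<in> {1..n-1} \<Longrightarrow> B i \<in> carrier_vec n" and C: "i \<in> {1..n-1} \<Longrightarrow> C i \<in> carrier_vec n" for i
    using star by (auto simp: star_rep_def)
  show "3 \<le> n" by fact
  show "eval_at x (H 1) = 0" "eval_at x (H 2) = \<nu> * x 1 ^ d" "eval_at x (H 3) = f (x 1) (x 2)" for x
    by (simp_all add: H1[simplified] H2 H3 eval_at.hom_mult eval_at.hom_power)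
  have eval: "eval_at x (H k) = (a k * x 1 + b k * x 2 + c k * x 3) ^ d" if "k \<in> {4..2*d+2}" for k x
    by (simp add: H_power[OF that] eval_at.hom_mult eval_at.hom_power eval_at.hom_add)
  show "y k = 0" if y: "\<And>x x'. x 1 = x' 1 \<Longrightarrow> x 2 = x' 2 \<Longrightarrow>
      (\<Sum>k=4..n. y k * eval_at x (H k)) = (\<Sum>k=4..n. y k * eval_at x' (H k))" and k: "k \<in> {4..n}" for y k
  proof -
    \<comment> \<open>Extension by zero reduces independence of H_4, ..., H_n to that of the full
      list up to H_(2d+2).\<close>
    define y' where "y' k = (if k \<le> n then y k else 0)" for k
    have eq: "(\<Sum>k=4..2*d+2. y' k * (a k * x 1 + b k * x 2 + c k * x 3) ^ d) =
        (\<Sum>k=4..n. y k * eval_at x (H k))" for x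
    proof -
      have "(\<Sum>k=4..n. y k * eval_at x (H k)) = (\<Sum>k=4..n. y' k * (a k * x 1 + b k * x 2 + c k * x 3) ^ d)"
        using n by (intro sum.cong refl) (simp add: y'_def eval)
      also have "\<dots> = (\<Sum>k=4..2*d+2. y' k * (a k * x 1 + b k * x 2 + c k * x 3) ^ d)"
        using n by (intro sum.mono_neutral_left) (auto simp: y'_def)
      finally show ?thesis by simp
    qed
    have "y' k = 0"
    proof (rule indep)
      fix s t r
      show "(\<Sum>k=4..2*d+2. y' k * (a k * s + b k * t + c k * r) ^ d) =
          (\<Sum>k=4..2*d+2. y' k * (a k * s + b k * t) ^ d)"
        \<comment> \<open>The points (s,t,r) and (s,t,0) agree in x_1 and x_2; their other
          coordinates do not enter the forms.\<close>
        using y[of "\<lambda>i. if i = 1 then s else if i = 2 then t else r" "\<lambda>i. if i = 1 then s else if i = 2 then t else 0"]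
        unfolding eq[symmetric] by simp
    qed (use k n in auto)
    then show ?thesis using k by (simp add: y'_def)
  qed
  show "u = 0 \<and> v = 0" if "\<And>s t. f (s + u) (t + v) = f s t" for u v
    using no_period that by blast
  show "eval_at x (H k) = (\<Sum>i=1..n-1. B i $ (k - 1) * (\<Sum>j=1..n. C i $ (j - 1) * x j) ^ e i)"
    if k: "k \<in> {1..n}" for k x
  proof -
    have "eval_at x (lin_form (C i)) = (\<Sum>j=1..n. C i $ (j - 1) * x j)" if "i \<in> {1..n-1}" for i
    proof -
      have "(\<Sum>j=1..n. C i $ (j - 1) * x j) = (\<Sum>j=1..n. C i $ (j - 1) * x (Suc (j - 1)))"
        by (intro sum.cong) auto
      also have "\<dots> = (\<Sum>j<n. C i $ j * x (Suc j))" by (rule sum_pred)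
      finally show ?thesis using C[OF that] by (simp add: eval_at_lin_form)
    qed
    then show ?thesis
      by (simp add: star_rep_index[OF star k] eval_at.hom_sum eval_at.hom_mult eval_at.hom_power mult.commute)
  qed
  show "(\<Sum>k=1..n. C j $ (k - 1) * B i $ (k - 1)) = 0" if "i \<in> {1..n-1}" "j \<in> {1..i}" for i j
  proof -
    have "(\<Sum>k=1..n. C j $ (k - 1) * B i $ (k - 1)) = (\<Sum>k<n. C j $ k * B i $ k)" by (rule sum_pred)
    also have "\<dots> = C j \<bullet> B i" using scalar_prod_sum[OF B[OF that(1)]] by simp
    also have "\<dots> = 0" using star that unfolding star_rep_def by blast
    finally show ?thesis .
  qed
  show "1 \<le> e i" if "i \<in> {1..n-1}" for i using star that by (auto simp: star_rep_def)
qed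

lemma first_forms:
  assumes n: "3 \<le> n" "n \<le> 2 * d + 2" and star: "star_rep n d (n - 1) B C e (map_of_polys n H)"
  shows "C 1 \<in> span_vecs n {unit_vec n 0, unit_vec n 1}"
    and "C 2 \<in> span_vecs n {unit_vec n 0, unit_vec n 1}"
    and "lin_indpt_family n C {1, 2}"
proof -
  interpret few_powers n d \<nu> f "\<lambda>k x. eval_at x (H k)" "\<lambda>i k. B i $ (k - 1)" "\<lambda>i j. C i $ (j - 1)" e
    by (rule few_powers[OF assms])
  have C: "C 1 \<in> carrier_vec n" "C 2 \<in> carrier_vec n"
    using star first_two(1,2) by (auto simp: star_rep_def)
  show "C 1 \<in> span_vecs n {unit_vec n 0, unit_vec n 1}"
    using n C first_form[of "Suc j" for j] by (intro in_span_unit_vecs) auto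
  show "C 2 \<in> span_vecs n {unit_vec n 0, unit_vec n 1}"
    using n C second_form[of "Suc j" for j] by (intro in_span_unit_vecs) auto
  have "y 1 = 0 \<and> y 2 = 0" if y: "\<forall>k<n. (\<Sum>i\<in>{1, 2}. y i * C i $ k) = 0" for y
  proof -
    have e0: "y 1 * C 1 $ 0 + y 2 * C 2 $ 0 = 0" and e1: "y 1 * C 1 $ 1 + y 2 * C 2 $ 1 = 0"
      using y[rule_format, of 0] y[rule_format, of 1] n by simp_all
    let ?D = "C 1 $ 0 * C 2 $ 1 - C 1 $ 1 * C 2 $ 0"
    have "?D * y 1 = C 2 $ 1 * (y 1 * C 1 $ 0 + y 2 * C 2 $ 0) - C 2 $ 0 * (y 1 * C 1 $ 1 + y 2 * C 2 $ 1)"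
      "?D * y 2 = C 1 $ 0 * (y 1 * C 1 $ 1 + y 2 * C 2 $ 1) - C 1 $ 1 * (y 1 * C 1 $ 0 + y 2 * C 2 $ 0)"
      by (simp_all add: algebra_simps)
    then have "?D * y 1 = 0" "?D * y 2 = 0" by (simp_all only: e0 e1) simp_all
    moreover have "?D \<noteq> 0" using det_nonzero by simp
    ultimately show ?thesis by simp
  qed
  then show "lin_indpt_family n C {1, 2}"
    using C by (subst lin_indpt_family_iff) auto
qed

lemma star3_imp_\<nu>_nonzero:
  assumes n: "3 \<le> n" "n \<le> 2 * d + 2" and "star3 n d (map_of_polys n H)"
  shows "\<nu> \<noteq> 0"
proof
  assume "\<nu> = 0"
  obtain B C e where star: "star_rep n d (n - 1) B C e (map_of_polys n H)"
    and li: "lin_indpt_family n B {1..n-1}"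
    using assms by (auto simp: star3_def)
  interpret few_powers n d \<nu> f "\<lambda>k x. eval_at x (H k)" "\<lambda>i k. B i $ (k - 1)" "\<lambda>i j. C i $ (j - 1)" e
    by (rule few_powers[OF n star])
  obtain y where y: "\<exists>i\<in>{1..n-1}. y i \<noteq> 0" "\<forall>k\<in>{1..n}. (\<Sum>i=1..n-1. y i * B i $ (k - 1)) = 0"
    using dependent[OF \<open>\<nu> = 0\<close>] by blast
  have "\<forall>k<n. (\<Sum>i=1..n-1. y i * B i $ k) = 0"
    using y(2) by (metis Suc_leI atLeastAtMost_iff diff_Suc_1 le_add1 plus_1_eq_Suc)
  moreover have "\<And>i. i \<in> {1..n-1} \<Longrightarrow> B i \<in> carrier_vec n" using star by (auto simp: star_rep_def)
  ultimately show False using li y(1) by (subst (asm) lin_indpt_family_iff) blast+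
qed

end

section \<open>The family (A)\<close>

lemma split_indices:
  fixes F :: "nat \<Rightarrow> 'b::comm_monoid_add"
  assumes "2 \<le> d"
  shows "(\<Sum>k=4..2*d+2. F k) = (\<Sum>k=4..d+2. F k) + (\<Sum>k=d+3..2*d+2. F k)"
proof -
  have "{4..2*d+2} = {4..d+2} \<union> {d+3..2*d+2}" using assms by auto
  then show ?thesis by (simp add: sum.union_disjoint)
qed

lemma shift_indices:
  fixes F :: "nat \<Rightarrow> 'b::comm_monoid_add"
  shows "(\<Sum>k=i+l..j+l. F k) = (\<Sum>k=i..j. F (k + l))"
  by (rule sum.shift_bounds_cl_nat_ivl)

text \<open>This is \<open>alternating_power_sum_translate\<close> for the starting points x_1 and
  x_2 with step x_3. The terms at i = 0 combine to H_3, and the term at i = 1 on the x_1 side is the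
  power missing from H.\<close>

lemma case_A_identity:
  assumes d: "2 \<le> d" and A: "case_A d \<nu> H"
  shows "of_nat d * (var 1 + var 3) ^ d =
    H 3 + (\<Sum>i = 2..d. (- 1) ^ i * of_nat (d choose i) * H (i + 2))
        - (\<Sum>i = 1..d. (- 1) ^ i * of_nat (d choose i) * H (i + d + 2))"
proof -
  let ?F = "\<lambda>x i. (-1) ^ i * of_nat (d choose i) * (x + of_nat i * var 3 :: 'a mpoly) ^ d"
  have "{..d} = insert 0 (insert 1 {2..d})" using d by auto
  then have 1: "(\<Sum>i\<le>d. ?F (var 1) i) = var 1 ^ d - of_nat d * (var 1 + var 3) ^ d + (\<Sum>i=2..d. ?F (var 1) i)"
    by simp
  have "{..d} = insert 0 {1..d}" by auto
  then have 2: "(\<Sum>i\<le>d. ?F (var 2) i) = var 2 ^ d + (\<Sum>i=1..d. ?F (var 2) i)"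
    by simp
  have H: "(\<Sum>i = 2..d. (- 1) ^ i * of_nat (d choose i) * H (i + 2)) = (\<Sum>i=2..d. ?F (var 1) i)"
    "(\<Sum>i = 1..d. (- 1) ^ i * of_nat (d choose i) * H (i + d + 2)) = (\<Sum>i=1..d. ?F (var 2) i)"
    using A by (auto simp: case_A_def intro!: sum.cong)
  have H3: "H 3 = var 1 ^ d - var 2 ^ d" using A by (simp add: case_A_def)
  have eq: "var 1 ^ d - of_nat d * (var 1 + var 3) ^ d + (\<Sum>i=2..d. ?F (var 1) i) =
      var 2 ^ d + (\<Sum>i=1..d. ?F (var 2) i)"
    unfolding 1[symmetric] 2[symmetric] by (rule alternating_power_sum_translate)
  have rearrange: "r = x - y + s - t" if "x - r + s = y + t" for r s t x y :: "'a mpoly"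
  proof -
    have "r = x + s - (y + t)" unfolding that[symmetric] by simp
    then show ?thesis by simp
  qed
  show ?thesis unfolding H H3 by (rule rearrange[OF eq])
qed

text \<open>At (s,t) = (1,0) the coefficients of r^1, ..., r^(d-1) see only the first block and give
  d - 1 equations for its d - 1 unknowns. With that block gone, (0,1) and r^1, ..., r^d give d
  equations for the d unknowns of the second.\<close>

lemma case_A_indep:
  fixes y :: "nat \<Rightarrow> 'a::field_char_0"
  assumes d: "2 \<le> d"
  defines "a \<equiv> \<lambda>k. if k \<le> d + 2 then 1 else 0 :: 'a"
    and "b \<equiv> \<lambda>k. if k \<le> d + 2 then 0 else 1 :: 'a"
    and "c \<equiv> \<lambda>k. of_nat (if k \<le> d + 2 then k - 2 else k - d - 2) :: 'a"
  assumes eq: "\<And>s t r. (\<Sum>k=4..2*d+2. y k * (a k * s + b k * t + c k * r) ^ d) =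
      (\<Sum>k=4..2*d+2. y k * (a k * s + b k * t) ^ d)"
    and k: "k \<in> {4..2*d+2}"
  shows "y k = 0"
proof -
  have lo: "y k = 0" if k: "k \<in> {4..d+2}" for k
  proof -
    \<comment> \<open>The coefficient of r^0 is unknown, so the equations start at exponent 1. The
      extra factor is absorbed into the unknown and cancelled afterwards, as all nodes are
      nonzero.\<close>
    have "y k * of_nat (k - 2) = 0"
    proof (rule vandermonde_trivial[of "{4..d+2}" "\<lambda>k. of_nat (k - 2)" "\<lambda>k. y k * of_nat (k - 2)"])
      show "inj_on (\<lambda>k. of_nat (k - 2) :: 'a) {4..d+2}" by (auto simp: inj_on_def)
      fix j assume "j < card {4..d+2}"
      then have j: "Suc j \<le> d" "d - Suc j \<noteq> 0" using d by auto
      have "(\<Sum>k=4..2*d+2. y k * c k ^ Suc j * a k ^ (d - Suc j)) = 0"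
        by (rule coeff_power_sum_zero) (use eq[of 1 0] j in auto)
      moreover have "(\<Sum>k=4..2*d+2. y k * c k ^ Suc j * a k ^ (d - Suc j)) =
          (\<Sum>k=4..d+2. y k * c k ^ Suc j * a k ^ (d - Suc j))"
        using j by (intro sum.mono_neutral_right) (auto simp: a_def)
      ultimately show "(\<Sum>k=4..d+2. y k * of_nat (k - 2) * of_nat (k - 2) ^ j) = 0"
        by (simp add: a_def c_def mult.assoc)
    qed (use k in auto)
    then show ?thesis using k by auto
  qed
  have "y k = 0" if k: "k \<in> {d+3..2*d+2}" for k
  proof -
    have "y k * of_nat (k - d - 2) = 0"
    proof (rule vandermonde_trivial[of "{d+3..2*d+2}" "\<lambda>k. of_nat (k - d - 2)" "\<lambda>k. y k * of_nat (k - d - 2)"])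
      show "inj_on (\<lambda>k. of_nat (k - d - 2) :: 'a) {d+3..2*d+2}" by (auto simp: inj_on_def)
      fix j assume "j < card {d+3..2*d+2}"
      then have j: "Suc j \<le> d" by auto
      have "(\<Sum>k=4..2*d+2. y k * c k ^ Suc j * b k ^ (d - Suc j)) = 0"
        by (rule coeff_power_sum_zero) (use eq[of 0 1] j in auto)
      moreover have "(\<Sum>k=4..2*d+2. y k * c k ^ Suc j * b k ^ (d - Suc j)) =
          (\<Sum>k=d+3..2*d+2. y k * c k ^ Suc j * b k ^ (d - Suc j))"
        using j lo d by (intro sum.mono_neutral_right) auto
      ultimately show "(\<Sum>k=d+3..2*d+2. y k * of_nat (k - d - 2) * of_nat (k - d - 2) ^ j) = 0"
        by (simp add: b_def c_def mult.assoc)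
    qed (use k in auto)
    then show ?thesis using k by auto
  qed
  then show ?thesis using lo k by (cases "k \<le> d + 2") auto
qed

lemma two_power_eq_two:
  assumes "(2 :: 'a::field_char_0) ^ d = 2"
  shows "d = 1"
proof -
  have "of_nat (2 ^ d) = (of_nat 2 :: 'a)" using assms by simp
  then have "(2::nat) ^ d = 2 ^ 1" by (simp only: of_nat_eq_iff) simp
  then show ?thesis by (simp only: power_inject_exp)
qed

text \<open>Two points suffice: (0,0) gives u^d = v^d, and then (u,0) gives (2^d - 2) u^d =
  0.\<close>

lemma case_A_no_period:
  fixes u v :: "'a::field_char_0"
  assumes d: "2 \<le> d" and eq: "\<And>s t. (s + u) ^ d - (t + v) ^ d = s ^ d - t ^ d"
  shows "u = 0 \<and> v = 0"
proof -
  have uv: "u ^ d = v ^ d" using eq[of 0 0] d by (simp add: power_0_left)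
  have "(2 * u) ^ d - v ^ d = u ^ d" using eq[of u 0, folded mult_2] d by (simp add: power_0_left)
  then have "2 ^ d * u ^ d - u ^ d = u ^ d" by (simp only: uv power_mult_distrib)
  then have "(2 ^ d - 2) * u ^ d = 0" by (simp add: left_diff_distrib diff_eq_eq)
  moreover have "(2 :: 'a) ^ d - 2 \<noteq> 0" using two_power_eq_two[of d] d by auto
  ultimately have "u ^ d = 0" by simp
  then show ?thesis using uv d by (simp add: power_0_left)
qed

text \<open>The weights \<open>w\<close> are those of \<open>case_A_identity\<close> divided by d,
  which yields the omitted power of x_1 + x_3. Two powers suffice for H_3, being a difference of
  pure powers.\<close>

lemma case_A_special_map:
  fixes \<nu> :: "'a::field_char_0"
  assumes d: "2 \<le> d" and A: "case_A d \<nu> H"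
  shows "special_map d \<nu> H (\<lambda>s t. s ^ d - t ^ d)
    (\<lambda>k. if k \<le> d + 2 then 1 else 0) (\<lambda>k. if k \<le> d + 2 then 0 else 1)
    (\<lambda>k. of_nat (if k \<le> d + 2 then k - 2 else k - d - 2))
    2 (\<lambda>i. if i = 1 then 1 else - 1) (\<lambda>i. if i = 1 then 1 else 0) (\<lambda>i. if i = 1 then 0 else 1)
    (\<lambda>k. (if k = 3 then 1 else if k \<le> d + 2 then (- 1) ^ (k - 2) * of_nat (d choose (k - 2))
      else - ((- 1) ^ (k - d - 2) * of_nat (d choose (k - d - 2)))) / of_nat d) 1 0 1"
proof
  show "2 \<le> d" by fact
  show H12: "H 1 = 0" "H 2 = Const \<nu> * var 1 ^ d" using A by (simp_all add: case_A_def)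
  have H3: "H 3 = var 1 ^ d - var 2 ^ d" using A by (simp add: case_A_def)
  show "eval_at x (H 3) = x 1 ^ d - x 2 ^ d" for x
    by (simp add: H3 eval_at.hom_minus eval_at.hom_power)
  have Hlo: "H k = (var 1 + of_nat (k - 2) * var 3) ^ d" if "k \<in> {4..d+2}" for k
  proof -
    have "k - 2 \<in> {2..d}" using that by auto
    then have "H (k - 2 + 2) = (var 1 + of_nat (k - 2) * var 3) ^ d" using A unfolding case_A_def by blast
    moreover have "k - 2 + 2 = k" using that by auto
    ultimately show ?thesis by (simp only:)
  qed
  have Hhi: "H k = (var 2 + of_nat (k - d - 2) * var 3) ^ d" if "k \<in> {d+3..2*d+2}" for k
  proof -
    have "k - d - 2 \<in> {1..d}" using that by auto
    then have "H (k - d - 2 + d + 2) = (var 2 + of_nat (k - d - 2) * var 3) ^ d" using A unfolding case_A_def by blast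
    moreover have "k - d - 2 + d + 2 = k" using that by auto
    ultimately show ?thesis by (simp only:)
  qed
  show "H k = (Const (if k \<le> d + 2 then 1 else 0) * var 1 + Const (if k \<le> d + 2 then 0 else 1) * var 2 +
      Const (of_nat (if k \<le> d + 2 then k - 2 else k - d - 2)) * var 3) ^ d" if "k \<in> {4..2*d+2}" for k
    using that by (cases "k \<le> d + 2") (simp_all add: Hlo Hhi Const.hom_of_nat del: of_nat_diff)
  show "H 3 = (\<Sum>i=1..2::nat. Const (if i = 1 then 1 else - 1) *
      (Const (if i = 1 then 1 else 0) * var 1 + Const (if i = 1 then 0 else 1) * var 2) ^ d)"
    by (simp add: H3 numeral_2_eq_2 Const.hom_uminus)
  show "u = 0 \<and> v = 0" if "\<And>s t. (s + u) ^ d - (t + v) ^ d = s ^ d - t ^ d" for u v :: 'a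
    using case_A_no_period[OF d that] .
  show "y k = 0" if "\<And>s t r. (\<Sum>k = 4..2 * d + 2. y k *
      ((if k \<le> d + 2 then 1 else 0) * s + (if k \<le> d + 2 then 0 else 1) * t +
       of_nat (if k \<le> d + 2 then k - 2 else k - d - 2) * r) ^ d) =
      (\<Sum>k = 4..2 * d + 2. y k * ((if k \<le> d + 2 then 1 else 0) * s + (if k \<le> d + 2 then 0 else 1) * t) ^ d)"
    "k \<in> {4..2 * d + 2}" for y :: "nat \<Rightarrow> 'a" and k
    using case_A_indep[OF d that] .
  let ?w = "\<lambda>k. (if k = 3 then 1 else if k \<le> d + 2 then (- 1) ^ (k - 2) * of_nat (d choose (k - 2))
      else - ((- 1) ^ (k - d - 2) * of_nat (d choose (k - d - 2)))) :: 'a"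
  have "(\<Sum>k=3..2*d+2. Const (?w k) * H k) = H 3 + (\<Sum>k=4..2*d+2. Const (?w k) * H k)"
    using d by (subst sum.atLeast_Suc_atMost) auto
  also have "(\<Sum>k=4..2*d+2. Const (?w k) * H k) =
      (\<Sum>k=4..d+2. Const (?w k) * H k) + (\<Sum>k=d+3..2*d+2. Const (?w k) * H k)"
    by (rule split_indices[OF d])
  also have "(\<Sum>k=4..d+2. Const (?w k) * H k) = (\<Sum>k=2..d. Const (?w (k + 2)) * H (k + 2))"
    using shift_indices[of "\<lambda>k. Const (?w k) * H k" 2 2 d] by simp
  also have "\<dots> = (\<Sum>k=2..d. (- 1) ^ k * of_nat (d choose k) * H (k + 2))"
    by (intro sum.cong) (auto simp: Const.hom_mult Const.hom_power Const.hom_uminus Const.hom_of_nat)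
  also have "(\<Sum>k=d+3..2*d+2. Const (?w k) * H k) = (\<Sum>k=1..d. Const (?w (k + d + 2)) * H (k + d + 2))"
    using shift_indices[of "\<lambda>k. Const (?w k) * H k" 1 "d+2" d] by (simp add: add.assoc mult_2 numeral_3_eq_3)
  also have "\<dots> = - (\<Sum>k=1..d. (- 1) ^ k * of_nat (d choose k) * H (k + d + 2))"
    unfolding sum_negf[symmetric]
    by (intro sum.cong) (auto simp: Const.hom_mult Const.hom_power Const.hom_uminus Const.hom_of_nat)
  finally have "(\<Sum>k=3..2*d+2. Const (?w k) * H k) = of_nat d * (var 1 + var 3) ^ d"
    using case_A_identity[OF d A] by simp
  then have "Const (1 / of_nat d) * (\<Sum>k=3..2*d+2. Const (?w k) * H k) =
      Const (1 / of_nat d) * (Const (of_nat d) * (var 1 + var 3) ^ d)"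
    by (simp add: Const.hom_of_nat)
  also have "\<dots> = Const (1 / of_nat d * of_nat d) * (var 1 + var 3) ^ d"
    by (simp only: Const.hom_mult mult.assoc)
  also have "\<dots> = (Const 1 * var 1 + Const 0 * var 2 + Const 1 * var 3) ^ d" using d by simp
  finally have *: "Const (1 / of_nat d) * (\<Sum>k=3..2*d+2. Const (?w k) * H k) =
      (Const 1 * var 1 + Const 0 * var 2 + Const 1 * var 3) ^ d" .
  have **: "(\<Sum>k=3..2*d+2. Const (?w k / of_nat d) * H k) = Const (1 / of_nat d) * (\<Sum>k=3..2*d+2. Const (?w k) * H k)"
    unfolding sum_distrib_left mult.assoc[symmetric] Const.hom_mult[symmetric] by simp
  show "(\<Sum>k=3..2*d+2. Const (?w k / of_nat d) * H k) = (Const 1 * var 1 + Const 0 * var 2 + Const 1 * var 3) ^ d"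
    unfolding ** * ..
  show "?w 3 / of_nat d \<noteq> 0" using d by simp
qed

section \<open>The family (B)\<close>

lemma split_indices_B:
  fixes F :: "nat \<Rightarrow> 'b::comm_monoid_add"
  assumes "2 \<le> d"
  shows "(\<Sum>k=4..2*d+2. F k) = (\<Sum>i=1..d-1. F (i + 3)) + (\<Sum>i<d. F (i + d + 3))"
proof -
  have "(\<Sum>k=4..d+2. F k) = (\<Sum>i=1..d-1. F (i + 3))"
    by (rule sum.reindex_bij_witness[of _ "\<lambda>i. i + 3" "\<lambda>k. k - 3"]) (use assms in auto)
  moreover have "(\<Sum>k=d+3..2*d+2. F k) = (\<Sum>i<d. F (i + d + 3))"
    by (rule sum.reindex_bij_witness[of _ "\<lambda>i. i + d + 3" "\<lambda>k. k - d - 3"]) (use assms in auto)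
  ultimately show ?thesis using split_indices[OF assms, of F] by simp
qed

text \<open>Adding \<open>root_of_unity_power_sum\<close> for y = x_2 + x_3 and y = x_2 - x_3
  cancels x_3 on the right. The term at i = 0 of the first sum is the power missing from H; since
  zeta^d = 1, the weights run on through the second block.\<close>

lemma case_B_identity:
  fixes \<zeta> :: "'a::field_char_0"
  assumes d: "2 \<le> d" and B: "case_B d \<nu> \<zeta> H"
  shows "(var 1 + var 2 + var 3) ^ d =
    of_nat (2 * d ^ 2) * H 3 - (\<Sum>i = 1..2 * d - 1. Const (\<zeta> ^ i) * H (i + 3))"
proof -
  have \<zeta>: "primitive_root_of_unity d \<zeta>" and \<zeta>d: "\<zeta> ^ d = 1"
    using B by (auto simp: case_B_def primitive_root_of_unity_def)
  let ?S = "\<lambda>y. \<Sum>i<d. Const (\<zeta> ^ i) * (Const (\<zeta> ^ i) * var 1 + y) ^ d"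
  have "(\<Sum>i = 1..2 * d - 1. Const (\<zeta> ^ i) * H (i + 3)) = (\<Sum>k=4..2*d+2. Const (\<zeta> ^ (k - 3)) * H k)"
    by (rule sum.reindex_bij_witness[of _ "\<lambda>k. k - 3" "\<lambda>i. i + 3"]) (use d in auto)
  also have "\<dots> = (\<Sum>i=1..d-1. Const (\<zeta> ^ i) * H (i + 3)) + (\<Sum>i<d. Const (\<zeta> ^ (i + d)) * H (i + d + 3))"
    using split_indices_B[OF d, of "\<lambda>k. Const (\<zeta> ^ (k - 3)) * H k"] by simp
  also have "(\<Sum>i=1..d-1. Const (\<zeta> ^ i) * H (i + 3)) = ?S (var 2 + var 3) - (var 1 + var 2 + var 3) ^ d"
  proof -
    have "{..<d} = insert 0 {1..d-1}" using d by auto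
    then have "?S (var 2 + var 3) = (var 1 + (var 2 + var 3)) ^ d +
        (\<Sum>i=1..d-1. Const (\<zeta> ^ i) * (Const (\<zeta> ^ i) * var 1 + (var 2 + var 3)) ^ d)" by simp
    also have "(\<Sum>i=1..d-1. Const (\<zeta> ^ i) * (Const (\<zeta> ^ i) * var 1 + (var 2 + var 3)) ^ d) =
        (\<Sum>i=1..d-1. Const (\<zeta> ^ i) * H (i + 3))"
      using B by (intro sum.cong) (auto simp: case_B_def add.assoc)
    finally show ?thesis by (simp add: add.assoc)
  qed
  also have "(\<Sum>i<d. Const (\<zeta> ^ (i + d)) * H (i + d + 3)) = ?S (var 2 - var 3)"
    using B by (intro sum.cong) (auto simp: case_B_def power_add \<zeta>d add_diff_eq)
  also have "?S (var 2 + var 3) = of_nat (d ^ 2) * (var 1 ^ (d - 1) * (var 2 + var 3))"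
    by (rule root_of_unity_power_sum[OF \<zeta> d])
  also have "?S (var 2 - var 3) = of_nat (d ^ 2) * (var 1 ^ (d - 1) * (var 2 - var 3))"
    by (rule root_of_unity_power_sum[OF \<zeta> d])
  finally show ?thesis using B by (simp add: case_B_def algebra_simps)
qed

text \<open>Let Y_i and Z_i be the unknowns at the forms with + x_3 and - x_3. Terms linear in x_3
  give d equations for the d differences Y_i - Z_i. As the first block has no form for i = 0, this
  also yields Z_0 = 0, so the d - 1 equations from terms quadratic in x_3 suffice for the remaining
  sums Y_i + Z_i.\<close>

lemma case_B_indep:
  fixes y :: "nat \<Rightarrow> 'a::field_char_0"
  assumes d: "2 \<le> d" and \<zeta>: "primitive_root_of_unity d \<zeta>"
  defines "c \<equiv> \<lambda>k. if k \<le> d + 2 then 1 else - 1 :: 'a"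
  assumes eq: "\<And>s t r. (\<Sum>k=4..2*d+2. y k * (\<zeta> ^ (k - 3) * s + 1 * t + c k * r) ^ d) =
      (\<Sum>k=4..2*d+2. y k * (\<zeta> ^ (k - 3) * s + 1 * t) ^ d)"
    and k: "k \<in> {4..2*d+2}"
  shows "y k = 0"
proof -
  have \<zeta>d: "\<zeta> ^ d = 1" using \<zeta> by (auto simp: primitive_root_of_unity_def)
  define Y where "Y i = (if i = 0 then 0 else y (i + 3))" for i
  define Z where "Z i = y (i + d + 3)" for i
  text \<open>The coefficients of $x_1^l x_2^{d-j-l} x_3^j$; only $j = 1, 2$ are needed.\<close>
  have coeff: "(\<Sum>i<d. (Y i + (-1) ^ j * Z i) * (\<zeta> ^ i) ^ l) = 0" if j: "1 \<le> j" "j \<le> d" "l \<le> d - j" for j l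
  proof -
    \<comment> \<open>Coefficients are extracted twice at t = 1, first of r^j and then of s^l. The
      second time the constant is known to be 0, so l = 0 is allowed.\<close>
    have "(\<Sum>k=4..2*d+2. y k * c k ^ j * (1 + \<zeta> ^ (k - 3) * s) ^ (d - j)) = 0" for s
      by (rule coeff_power_sum_zero[where c = "\<Sum>k=4..2*d+2. y k * (\<zeta> ^ (k - 3) * s + 1 * 1) ^ d"])
        (use eq[of s 1] j in \<open>auto simp: add_ac\<close>)
    then have "(\<Sum>k=4..2*d+2. (y k * c k ^ j) * (\<zeta> ^ (k - 3)) ^ l * 1 ^ (d - j - l)) = 0"
      by (rule coeff_power_sum_zero) (use j in auto)
    then have "(\<Sum>k=4..2*d+2. y k * c k ^ j * (\<zeta> ^ (k - 3)) ^ l) = 0" by simp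
    also have "(\<Sum>k=4..2*d+2. y k * c k ^ j * (\<zeta> ^ (k - 3)) ^ l) =
        (\<Sum>i=1..d-1. Y i * (\<zeta> ^ i) ^ l) + (\<Sum>i<d. (-1) ^ j * Z i * (\<zeta> ^ i) ^ l)"
      unfolding split_indices_B[OF d]
      by (intro arg_cong2[of _ _ _ _ "(+)"] sum.cong) (auto simp: Y_def Z_def c_def power_add \<zeta>d)
    also have "(\<Sum>i=1..d-1. Y i * (\<zeta> ^ i) ^ l) = (\<Sum>i<d. Y i * (\<zeta> ^ i) ^ l)"
      by (intro sum.mono_neutral_left) (use d in \<open>auto simp: Y_def\<close>)
    finally show ?thesis by (simp add: sum.distrib distrib_right)
  qed
  note inj = primitive_root_of_unity_inj[OF \<zeta>]
  have diff: "Y i - Z i = 0" if "i < d" for i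
    by (rule vandermonde_trivial[OF _ inj]) (use coeff[of 1] d that in auto)
  then have Z0: "Z 0 = 0" using d by (force simp: Y_def)
  have sum: "Y i + Z i = 0" if "i \<in> {1..d-1}" for i
  proof (rule vandermonde_trivial[of "{1..d-1}" "\<lambda>i. \<zeta> ^ i" "\<lambda>i. Y i + Z i"])
    show "inj_on (\<lambda>i. \<zeta> ^ i) {1..d-1}" by (rule inj_on_subset[OF inj]) (use d in auto)
    fix l assume "l < card {1..d-1}"
    then have "(\<Sum>i<d. (Y i + Z i) * (\<zeta> ^ i) ^ l) = 0" using coeff[of 2 l] d by simp
    moreover have "(\<Sum>i<d. (Y i + Z i) * (\<zeta> ^ i) ^ l) = (\<Sum>i=1..d-1. (Y i + Z i) * (\<zeta> ^ i) ^ l)"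
      by (intro sum.mono_neutral_right) (use d Z0 in \<open>auto simp: Y_def\<close>)
    ultimately show "(\<Sum>i=1..d-1. (Y i + Z i) * (\<zeta> ^ i) ^ l) = 0" by simp
  qed (use that in auto)
  have YZ: "Y i = 0 \<and> Z i = 0" if "i \<in> {1..d-1}" for i
  proof -
    have "Y i = Z i" "Y i + Z i = 0" using diff[of i] sum[OF that] that d by auto
    then show ?thesis by (simp add: mult_2[symmetric])
  qed
  show ?thesis
  proof (cases "k \<le> d + 2")
    case True
    then have "k - 3 \<in> {1..d-1}" "k = k - 3 + 3" using k by auto
    then show ?thesis using YZ[of "k - 3"] by (auto simp: Y_def split: if_splits)
  next
    case False
    then obtain i where "i < d" "k = i + d + 3" using k that[of "k - d - 3"] by auto
    then show ?thesis using YZ[of i] Z0 by (cases "i = 0") (auto simp: Z_def)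
  qed
qed

text \<open>If u is nonzero, the point (0,0) forces v = 0, and then (0,1) gives u^(d-1) = 0.\<close>

lemma case_B_no_period:
  fixes u v :: "'a::field_char_0"
  assumes d: "2 \<le> d" and eq: "\<And>s t. (s + u) ^ (d - 1) * (t + v) = s ^ (d - 1) * t"
  shows "u = 0 \<and> v = 0"
proof (cases "u = 0")
  case True
  then show ?thesis using eq[of 1 0] by simp
next
  case False
  then have "v = 0" using eq[of 0 0] d by simp
  then show ?thesis using eq[of 0 1] d by (simp add: power_0_left split: if_splits)
qed

text \<open>The d powers for H_3 come from \<open>root_of_unity_power_sum\<close> divided by d^2,
  the weights \<open>w\<close> from \<open>case_B_identity\<close>. The exponent k - 3 serves both
  blocks because zeta^d = 1.\<close>

lemma case_B_special_map:
  fixes \<nu> :: "'a::field_char_0"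
  assumes d: "2 \<le> d" and B: "case_B d \<nu> \<zeta> H"
  shows "special_map d \<nu> H (\<lambda>s t. s ^ (d - 1) * t)
    (\<lambda>k. \<zeta> ^ (k - 3)) (\<lambda>k. 1) (\<lambda>k. if k \<le> d + 2 then 1 else - 1)
    d (\<lambda>i. \<zeta> ^ (i - 1) / of_nat (d ^ 2)) (\<lambda>i. \<zeta> ^ (i - 1)) (\<lambda>i. 1)
    (\<lambda>k. if k = 3 then of_nat (2 * d ^ 2) else - (\<zeta> ^ (k - 3))) 1 1 1"
proof
  have \<zeta>: "primitive_root_of_unity d \<zeta>" and \<zeta>d: "\<zeta> ^ d = 1"
    using B by (auto simp: case_B_def primitive_root_of_unity_def)
  show "2 \<le> d" by fact
  show H12: "H 1 = 0" "H 2 = Const \<nu> * var 1 ^ d" using B by (simp_all add: case_B_def)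
  have H3: "H 3 = var 1 ^ (d - 1) * var 2" using B by (simp add: case_B_def)
  show "eval_at x (H 3) = x 1 ^ (d - 1) * x 2" for x
    by (simp add: H3 eval_at.hom_mult eval_at.hom_power)
  show "H k = (Const (\<zeta> ^ (k - 3)) * var 1 + Const 1 * var 2 +
      Const (if k \<le> d + 2 then 1 else - 1) * var 3) ^ d" if k: "k \<in> {4..2*d+2}" for k
  proof (cases "k \<le> d + 2")
    case True
    then have "k - 3 \<in> {1..d-1}" "k - 3 + 3 = k" using k by auto
    then have "H k = (Const (\<zeta> ^ (k - 3)) * var 1 + var 2 + var 3) ^ d"
      using B unfolding case_B_def by metis
    then show ?thesis using True by simp
  next
    case False
    then have i: "k - d - 3 \<in> {0..d-1}" "k - d - 3 + d + 3 = k" using k by auto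
    then have "H k = (Const (\<zeta> ^ (k - d - 3)) * var 1 + var 2 - var 3) ^ d"
      using B unfolding case_B_def by metis
    moreover have "\<zeta> ^ (k - 3) = \<zeta> ^ (k - d - 3)"
    proof -
      have "k - 3 = k - d - 3 + d" using i by auto
      then have "\<zeta> ^ (k - 3) = \<zeta> ^ (k - d - 3) * \<zeta> ^ d" by (simp only: power_add)
      then show ?thesis by (simp add: \<zeta>d)
    qed
    ultimately show ?thesis using False by (simp add: Const.hom_uminus)
  qed
  have "(\<Sum>i=1..d. Const (\<zeta> ^ (i - 1) / of_nat (d ^ 2)) * (Const (\<zeta> ^ (i - 1)) * var 1 + Const 1 * var 2) ^ d) =
      (\<Sum>i<d. Const (\<zeta> ^ i / of_nat (d ^ 2)) * (Const (\<zeta> ^ i) * var 1 + var 2) ^ d)"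
    by (subst sum_pred[symmetric]) simp
  also have "\<dots> = Const (1 / of_nat (d ^ 2)) * (\<Sum>i<d. Const (\<zeta> ^ i) * (Const (\<zeta> ^ i) * var 1 + var 2) ^ d)"
    unfolding sum_distrib_left mult.assoc[symmetric] Const.hom_mult[symmetric] by simp
  also have "\<dots> = Const (1 / of_nat (d ^ 2)) * (Const (of_nat (d ^ 2)) * H 3)"
    by (simp only: root_of_unity_power_sum[OF \<zeta> d] H3 Const.hom_of_nat)
  also have "\<dots> = Const (1 / of_nat (d ^ 2) * of_nat (d ^ 2)) * H 3" by (simp only: Const.hom_mult mult.assoc)
  also have "\<dots> = H 3" using d by simp
  finally show "H 3 = (\<Sum>i=1..d. Const (\<zeta> ^ (i - 1) / of_nat (d ^ 2)) *
      (Const (\<zeta> ^ (i - 1)) * var 1 + Const 1 * var 2) ^ d)" by (rule sym)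
  show "u = 0 \<and> v = 0" if "\<And>s t. (s + u) ^ (d - 1) * (t + v) = s ^ (d - 1) * t" for u v :: 'a
    using case_B_no_period[OF d that] .
  show "y k = 0" if "\<And>s t r. (\<Sum>k = 4..2 * d + 2. y k *
      (\<zeta> ^ (k - 3) * s + 1 * t + (if k \<le> d + 2 then 1 else - 1) * r) ^ d) =
      (\<Sum>k = 4..2 * d + 2. y k * (\<zeta> ^ (k - 3) * s + 1 * t) ^ d)"
    "k \<in> {4..2 * d + 2}" for y :: "nat \<Rightarrow> 'a" and k
    using case_B_indep[OF d \<zeta> that] .
  let ?w = "\<lambda>k. if k = 3 then of_nat (2 * d ^ 2) else - (\<zeta> ^ (k - 3))"
  have "(\<Sum>k=3..2*d+2. Const (?w k) * H k) = of_nat (2 * d ^ 2) * H 3 + (\<Sum>k=4..2*d+2. Const (?w k) * H k)"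
    using d by (subst sum.atLeast_Suc_atMost) (auto simp: Const.hom_of_nat Const.hom_mult Const.hom_power Const.hom_numeral)
  also have "(\<Sum>k=4..2*d+2. Const (?w k) * H k) = - (\<Sum>i = 1..2 * d - 1. Const (\<zeta> ^ i) * H (i + 3))"
    unfolding sum_negf[symmetric]
    by (rule sum.reindex_bij_witness[of _ "\<lambda>i. i + 3" "\<lambda>k. k - 3"]) (use d in \<open>auto simp: Const.hom_uminus\<close>)
  finally show "(\<Sum>k=3..2*d+2. Const (?w k) * H k) = (Const 1 * var 1 + Const 1 * var 2 + Const 1 * var 3) ^ d"
    using case_B_identity[OF d B] by simp
  show "?w 3 \<noteq> 0" using d by simp
qed

text \<open>For d = 2 such a basis exists because the quadratic form x_1 x_2 can be diagonalised.
  For larger d additivity already fails at a few points, chosen to make the first coordinates of p u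
  and q v proportional to u_1 v_1.\<close>

lemma additive_on_basis:
  fixes u1 u2 v1 v2 :: "'a::field_char_0"
  assumes d: "2 \<le> d" and det: "u1 * v2 - u2 * v1 \<noteq> 0"
    and eq: "\<And>p q. (p * u1 + q * v1) ^ (d - 1) * (p * u2 + q * v2) =
      (p * u1) ^ (d - 1) * (p * u2) + (q * v1) ^ (d - 1) * (q * v2)"
  shows "d = 2" and "v1 \<noteq> 0"
proof -
  have d1: "d - 1 \<noteq> 0" using d by simp
  show v1: "v1 \<noteq> 0"
  proof
    assume "v1 = 0"
    then show False using eq[of 1 1] det d1 by (simp add: distrib_left power_0_left)
  qed
  have u1: "u1 \<noteq> 0"
  proof
    assume "u1 = 0"
    then show False using eq[of 1 1] det d1 by (simp add: distrib_left power_0_left)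
  qed
  let ?W = "(u1 * v1) ^ (d - 1)"
  have W: "?W \<noteq> 0" using u1 v1 by simp
  \<comment> \<open>At (p,q) = (v_1, -u_1) the first coordinate cancels, so the left side is
    0.\<close>
  have e: "v1 * u2 = (-1) ^ (d - 1) * (u1 * v2)"
    using eq[of v1 "- u1"] d1 u1 v1
    by (simp add: power_mult_distrib power_minus[of "u1 * v1"] power_minus[of u1] mult_ac power_0_left)
  have odd: "odd (d - 1)"
  proof
    assume "even (d - 1)"
    then show False using e det by (simp add: mult_ac)
  qed
  then have e: "u1 * v2 = - (v1 * u2)" using e by simp
  then have X: "v1 * u2 \<noteq> 0" using det by (auto simp: mult_ac)
  \<comment> \<open>The point (2 v_1, u_1) gives the first coordinates 2 u_1 v_1 and u_1 v_1, with
    sum 3 u_1 v_1. Together with the sign relation this becomes 3^(d-1) + 1 = 2^d, which has no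
    solution with d >= 3.\<close>
  have "(2 * v1 * u1 + u1 * v1) ^ (d - 1) * (2 * (v1 * u2) + u1 * v2) =
      (2 * v1 * u1) ^ (d - 1) * (2 * (v1 * u2)) + ?W * (u1 * v2)"
    using eq[of "2 * v1" u1] by (simp add: mult.assoc)
  moreover have "2 * v1 * u1 + u1 * v1 = 3 * (u1 * v1)" "2 * v1 * u1 = 2 * (u1 * v1)"
    by (simp_all add: algebra_simps)
  ultimately have "(3 * (u1 * v1)) ^ (d - 1) * (v1 * u2) = (2 * (u1 * v1)) ^ (d - 1) * (2 * (v1 * u2)) - ?W * (v1 * u2)"
    by (simp only: e) (simp add: mult_ac)
  then have "?W * (v1 * u2) * (3 ^ (d - 1) + 1 - 2 * 2 ^ (d - 1)) = 0"
    by (simp add: power_mult_distrib algebra_simps)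
  then have "(3 :: 'a) ^ (d - 1) + 1 = 2 * 2 ^ (d - 1)" using W X by (simp only: mult_eq_0_iff) simp
  then have "of_nat (3 ^ (d - 1) + 1) = (of_nat (2 * 2 ^ (d - 1)) :: 'a)" by (simp add: add.commute)
  then have nat: "(3::nat) ^ (d - 1) + 1 = 2 * 2 ^ (d - 1)" by (simp only: of_nat_eq_iff)
  have "2 * 2 ^ k < (3::nat) ^ k" if "2 \<le> k" for k
    using that by (induction k rule: dec_induct) auto
  with nat have "\<not> 2 \<le> d - 1" by (metis add_lessD1 less_irrefl)
  then show "d = 2" using d by simp
qed

section \<open>Representations with $n-1$ powers\<close>

text \<open>The single power x_1^d serves both H_2 and H_3, through the vector b_1 with entries
  \<nu> and 1. This saves the extra layer that \<open>star1\<close> spends on H_2 and brings the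
  count down to 2 + (n - 3).\<close>

lemma case_A_star_rep:
  fixes \<nu> :: "'a::field_char_0"
  assumes d: "2 \<le> d" and A: "case_A d \<nu> H" and n: "3 \<le> n" "n \<le> 2 * d + 2"
  shows "\<exists>c. star_rep n d (n - 1) (layer_vec n 2 (\<lambda>i. if i = 1 then \<nu> else 0) (\<lambda>i. if i = 1 then 1 else - 1))
    c (\<lambda>_. d) (map_of_polys n H)"
proof -
  note sp = case_A_special_map[OF d A]
  have "n - 1 = 2 + (n - 3)" using n by simp
  have "\<exists>c. star_rep n d (2 + (n - 3)) (layer_vec n 2 (\<lambda>i. if i = 1 then \<nu> else 0) (\<lambda>i. if i = 1 then 1 else - 1))
      c (\<lambda>_. d) (map_of_polys n H)"
    by (rule special_map.layered_star_rep[OF sp n, where \<alpha>' = "\<lambda>i. if i = 1 then 1 else 0"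
      and \<beta>' = "\<lambda>i. if i = 1 then 0 else 1"])
      (use A in \<open>auto simp: case_A_def numeral_2_eq_2 Const.hom_uminus\<close>)
  then show ?thesis unfolding \<open>n - 1 = 2 + (n - 3)\<close> .
qed

text \<open>The vectors are triangular up to the zero first coordinate: at entry 1 only b_1 is
  nonzero, with value \<nu>, at entry 2 only b_1 and b_2, and the others are distinct unit
  vectors.\<close>

lemma case_A_star3:
  fixes \<nu> :: "'a::field_char_0"
  assumes d: "2 \<le> d" and A: "case_A d \<nu> H" and n: "3 \<le> n" "n \<le> 2 * d + 2" and \<nu>: "\<nu> \<noteq> 0"
  shows "star3 n d (map_of_polys n H)"
proof -
  let ?b = "layer_vec n 2 (\<lambda>i. if i = 1 then \<nu> else 0) (\<lambda>i. if i = 1 then 1 else - 1)"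
  have b: "?b i $ k = (if i = 1 then (if k = 1 then \<nu> else if k = 2 then 1 else 0)
      else if i = 2 then (if k = 2 then - 1 else 0) else if i = k then 1 else 0)"
    if "k < n" "i \<in> {1..n-1}" for i k
  proof (cases "i \<le> 2")
    case True
    then have "i = 1 \<or> i = 2" using that by auto
    then show ?thesis using that n by (auto simp: layer_vec_def vec3_def)
  next
    case False
    then show ?thesis using that n by (auto simp: layer_vec_def)
  qed
  have "lin_indpt_family n ?b {1..n-1}"
  proof (subst lin_indpt_family_iff)
    show "\<forall>y. (\<forall>k<n. (\<Sum>i=1..n-1. y i * ?b i $ k) = 0) \<longrightarrow> (\<forall>i\<in>{1..n-1}. y i = 0)"
    proof (intro allI impI ballI)
      fix y i assume y: "\<forall>k<n. (\<Sum>i=1..n-1. y i * ?b i $ k) = 0" and i: "i \<in> {1..n-1}"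
      have "(\<Sum>i=1..n-1. y i * ?b i $ 1) = (\<Sum>i\<in>{1}. y i * ?b i $ 1)"
        using n b by (intro sum.mono_neutral_right) auto
      then have y1: "y 1 = 0" using y[rule_format, of 1] n \<nu> b[of 1 1] by simp
      have "(\<Sum>i=1..n-1. y i * ?b i $ 2) = (\<Sum>i\<in>{2}. y i * ?b i $ 2)"
        using n b y1 by (intro sum.mono_neutral_right) auto
      then have y2: "y 2 = 0" using y[rule_format, of 2] n b[of 2 2] by simp
      show "y i = 0"
      proof (cases "i \<le> 2")
        case True
        then have "i = 1 \<or> i = 2" using i by auto
        then show ?thesis using y1 y2 by auto
      next
        case False
        have "(\<Sum>j=1..n-1. y j * ?b j $ i) = (\<Sum>j\<in>{i}. y j * ?b j $ i)"
          using n b[of i] y1 y2 i False by (intro sum.mono_neutral_right) (auto split: if_splits)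
        then show ?thesis using y[rule_format, of i] i n b[of i i] False by simp
      qed
    qed
  qed (use n in \<open>auto simp: layer_vec_def\<close>)
  then show ?thesis unfolding star3_def using case_A_star_rep[OF d A n] by blast
qed

lemma case_B_star2_imp:
  fixes \<nu> :: "'a::field_char_0"
  assumes d: "2 \<le> d" and B: "case_B d \<nu> \<zeta> H" and n: "3 \<le> n" "n \<le> 2 * d + 2"
    and star2: "star2 n d (map_of_polys n H)"
  shows "\<nu> = 0 \<and> d = 2"
proof -
  obtain b c e where star: "star_rep n d (n - 1) b c e (map_of_polys n H)"
    using star2 by (auto simp: star2_def)
  interpret few_powers n d \<nu> "\<lambda>s t. s ^ (d - 1) * t" "\<lambda>k x. eval_at x (H k)"
    "\<lambda>i k. b i $ (k - 1)" "\<lambda>i j. c i $ (j - 1)" e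
    by (rule special_map.few_powers[OF case_B_special_map[OF d B] n star])
  obtain u1 u2 v1 v2 where uv: "u1 * v2 - u2 * v1 \<noteq> 0"
    "c 1 $ (1 - 1) * v1 + c 1 $ (2 - 1) * v2 = 0"
    "\<And>p q. (p * u1 + q * v1) ^ (d - 1) * (p * u2 + q * v2) =
      (p * u1) ^ (d - 1) * (p * u2) + (q * v1) ^ (d - 1) * (q * v2)"
    by (rule additive_basis) (rule that; assumption)
  note additive_on_basis[OF d uv(1,3)]
  \<comment> \<open>L_1 vanishes at v, and v_1 is nonzero. If L_1 were a multiple of x_1, it would
    therefore be zero, against \<open>det_nonzero\<close>.\<close>
  moreover have "\<nu> = 0"
  proof (rule ccontr)
    assume "\<nu> \<noteq> 0"
    then have "c 1 $ (2 - 1) = 0" using first_form_2 by simp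
    then show False using uv(2) det_nonzero additive_on_basis(2)[OF d uv(1,3)] by simp
  qed
  ultimately show ?thesis by blast
qed

text \<open>Polarization 4 x_1 x_2 = (x_1 + x_2)^2 - (x_1 - x_2)^2 needs only two layers. Since H_2
  = 0, no b_i has an x_2 entry and orthogonality is automatic.\<close>

lemma case_B_star2:
  fixes \<zeta> :: "'a::field_char_0"
  assumes B: "case_B 2 0 \<zeta> H" and n: "3 \<le> n" "n \<le> 2 * 2 + 2"
  shows "star2 n 2 (map_of_polys n H)"
proof -
  note sp = case_B_special_map[OF order_refl B]
  have H: "H 2 = 0" "H 3 = var 1 * var 2" using B by (simp_all add: case_B_def)
  have "(\<Sum>i=1..2::nat. Const (if i = 1 then 1 / 4 else - (1 / 4)) *
      (Const 1 * var 1 + Const (if i = 1 then 1 else - 1) * var 2) ^ 2) =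
      Const (1 / 4) * ((var 1 + var 2) ^ 2 - (var 1 - var 2) ^ 2 :: 'a mpoly)"
    by (simp add: numeral_2_eq_2 Const.hom_uminus right_diff_distrib)
  also have "(var 1 + var 2) ^ 2 - (var 1 - var 2) ^ 2 = Const 4 * (var 1 * var 2 :: 'a mpoly)"
    by (simp add: power2_eq_square algebra_simps Const.hom_numeral)
  also have "Const (1 / 4) * \<dots> = Const (1 / 4 * 4) * (var 1 * var 2 :: 'a mpoly)"
    by (simp only: Const.hom_mult mult.assoc)
  also have "\<dots> = H 3" by (simp add: H)
  finally have H3: "H 3 = (\<Sum>i=1..2::nat. Const (if i = 1 then 1 / 4 else - (1 / 4)) *
      (Const 1 * var 1 + Const (if i = 1 then 1 else - 1) * var 2) ^ 2)" by (rule sym)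
  have "\<exists>c. star_rep n 2 (2 + (n - 3)) (layer_vec n 2 (\<lambda>_. 0) (\<lambda>i. if i = 1 then 1 / 4 else - (1 / 4)))
      c (\<lambda>_. 2) (map_of_polys n H)"
    by (rule special_map.layered_star_rep[OF sp n, where \<alpha>' = "\<lambda>_. 1"
      and \<beta>' = "\<lambda>i. if i = 1 then 1 else - 1"]) (use H(1) H3 in auto)
  moreover have "2 + (n - 3) = n - 1" using n by simp
  ultimately show ?thesis unfolding star2_def by metis
qed

theorem theorem5p3:
  fixes d :: nat and \<nu> :: "'a::field_char_0" and H :: "nat \<Rightarrow> 'a mpoly"
  assumes "d \<ge> 2"
    and "case_A d \<nu> H \<or> (\<exists>\<zeta>. case_B d \<nu> \<zeta> H)"
  shows "2 * d + 2 \<ge> 6 \<and>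
    (case_A d \<nu> H \<longrightarrow>
       of_nat d * (var 1 + var 3) ^ d =
         H 3 + (\<Sum>i = 2..d. (- 1) ^ i * of_nat (d choose i) * H (i + 2))
             - (\<Sum>i = 1..d. (- 1) ^ i * of_nat (d choose i) * H (i + d + 2))) \<and>
    (\<forall>\<zeta>. case_B d \<nu> \<zeta> H \<longrightarrow>
       (var 1 + var 2 + var 3) ^ d =
         of_nat (2 * d ^ 2) * H 3 - (\<Sum>i = 1..2 * d - 1. Const (\<zeta> ^ i) * H (i + 3))) \<and>
    (\<exists>T T' :: 'a mat.
       T \<in> carrier_mat (2 * d + 2) (2 * d + 2) \<and> T' \<in> carrier_mat (2 * d + 2) (2 * d + 2) \<and>
       inverts_mat T T' \<and> inverts_mat T' T \<and>
       power_linear (2 * d + 2) d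
         (map_mat Const T *\<^sub>v
            subst_map (map_of_polys (2 * d + 2) H) (map_mat Const T' *\<^sub>v var_vec (2 * d + 2)))) \<and>
    (\<forall>n. 3 \<le> n \<and> n \<le> 2 * d + 2 \<longrightarrow>
       map_of_polys n H \<in> poly_maps n \<and>
       star1 n d (map_of_polys n H) \<and>
       (\<forall>b c e. star_rep n d (n - 1) b c e (map_of_polys n H) \<longrightarrow>
          c 1 \<in> span_vecs n {unit_vec n 0, unit_vec n 1} \<and>
          c 2 \<in> span_vecs n {unit_vec n 0, unit_vec n 1} \<and>
          lin_indpt_family n c {1, 2}) \<and>
       (star2 n d (map_of_polys n H) \<longleftrightarrow>
          case_A d \<nu> H \<or> ((\<exists>\<zeta>. case_B d \<nu> \<zeta> H) \<and> H 2 = 0 \<and> d = 2)) \<and>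
       (star3 n d (map_of_polys n H) \<longleftrightarrow> case_A d \<nu> H \<and> H 2 \<noteq> 0))"
proof -
  have d: "2 \<le> d" by fact
  obtain f a b c m q \<alpha> \<beta> w l1 l2 l3 where sp: "special_map d \<nu> H f a b c m q \<alpha> \<beta> w l1 l2 l3"
    using assms(2)
  proof (elim disjE exE)
    assume "case_A d \<nu> H"
    then show ?thesis by (rule that[OF case_A_special_map[OF d]])
  next
    fix \<zeta> assume "case_B d \<nu> \<zeta> H"
    then show ?thesis by (rule that[OF case_B_special_map[OF d]])
  qed
  interpret special_map d \<nu> H f a b c m q \<alpha> \<beta> w l1 l2 l3 by (rule sp)
  have star2: "star2 n d (map_of_polys n H) \<longleftrightarrow>
      case_A d \<nu> H \<or> ((\<exists>\<zeta>. case_B d \<nu> \<zeta> H) \<and> H 2 = 0 \<and> d = 2)"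
    if n: "3 \<le> n" "n \<le> 2 * d + 2" for n
  proof
    assume "star2 n d (map_of_polys n H)"
    then show "case_A d \<nu> H \<or> ((\<exists>\<zeta>. case_B d \<nu> \<zeta> H) \<and> H 2 = 0 \<and> d = 2)"
      using assms(2) case_B_star2_imp[OF d _ n] H2_eq_0_iff by blast
  next
    assume "case_A d \<nu> H \<or> ((\<exists>\<zeta>. case_B d \<nu> \<zeta> H) \<and> H 2 = 0 \<and> d = 2)"
    then show "star2 n d (map_of_polys n H)"
    proof
      assume "case_A d \<nu> H"
      then show ?thesis using case_A_star_rep[OF d _ n] unfolding star2_def by blast
    next
      assume "(\<exists>\<zeta>. case_B d \<nu> \<zeta> H) \<and> H 2 = 0 \<and> d = 2"
      then show ?thesis using case_B_star2 n H2_eq_0_iff by blast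
    qed
  qed
  have star3: "star3 n d (map_of_polys n H) \<longleftrightarrow> case_A d \<nu> H \<and> H 2 \<noteq> 0"
    if n: "3 \<le> n" "n \<le> 2 * d + 2" for n
  proof
    assume s3: "star3 n d (map_of_polys n H)"
    then have "star2 n d (map_of_polys n H)" by (auto simp: star2_def star3_def)
    then show "case_A d \<nu> H \<and> H 2 \<noteq> 0"
      using star2[OF n] star3_imp_\<nu>_nonzero[OF n s3] H2_eq_0_iff by blast
  next
    assume "case_A d \<nu> H \<and> H 2 \<noteq> 0"
    then show "star3 n d (map_of_polys n H)"
      using case_A_star3[OF d _ n] H2_eq_0_iff by blast
  qed
  show ?thesis
  proof (intro conjI allI impI)
    show "6 \<le> 2 * d + 2" using d by simp
  qed ((elim conjE)?, (erule case_A_identity[OF d] | erule case_B_identity[OF d] | rule power_linear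
    | (rule poly_maps; assumption) | (rule star1; assumption) | (rule first_forms; assumption)
    | (rule star2; assumption) | (rule star3; assumption)))+
qed

end
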